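(* Let $\varphi$ be a non-negative increasing $C^1$ function on $[0,\infty)$ with $\varphi(0)=0$. Let $\alpha,\beta\in\mathbb{C}$ with $\operatorname{Re}(\alpha)>0$, $\operatorname{Re}(\beta)>0$, and let $\mathcal{A}(x)=\sum_{n=0}^\infty a_nx^n$ be analytic on a complex disc $\mathcal{D}(0,R)$, where $R>(b-a)^{\operatorname{Re}(\beta)}$ for the interval $[a,b]$ on which the fractional integral is taken (here $a=0$). Assume that the function $u:[0,\infty)\to\mathbb{R}$ is of $\varphi$-exponential order, piecewise continuous over each finite interval $[0,T]$, with generalised Laplace transform $\hat u$. Then the function ${}^{\mathcal{A}}_{0}I^{\alpha,\beta}_{\varphi(x)}u(x)$ has a generalised Laplace transform given by $$\mathcal{L}_\varphi\left\{{}^{\mathcal{A}}_{0}I^{\alpha,\beta}_{\varphi(x)}u(x)\right\}(s)=s^{-\alpha}\,\mathcal{A}_\Gamma(s^{-\beta})\,\hat u(s).$$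
   Context: The generalised Laplace transform (Laplace transform with respect to $\varphi$) of a function $f$ on $[0,\infty)$ is $$\mathcal{L}_\varphi\{f(x)\}(s)=\hat f(s)=\int_0^\infty e^{-s\varphi(x)}\varphi'(x)f(x)\,dx$$ for all $s\in\mathbb{C}$ such that this integral converges. A function $f$ on $[0,\infty)$ is of $\varphi$-exponential order $c>0$ if there are positive constants $M,X$ with $|f(x)|\le Me^{c\varphi(x)}$ for all $x>X$. The generalised fractional integral with analytic kernel $\mathcal{A}$ with respect to $\varphi$ is $${}^{\mathcal{A}}_{0}I^{\alpha,\beta}_{\varphi(x)}u(x)=\int_0^x\varphi'(t)[\varphi(x)-\varphi(t)]^{\alpha-1}\mathcal{A}\big([\varphi(x)-\varphi(t)]^\beta\big)u(t)\,dt .$$ The transformed function is $\mathcal{A}_\Gamma(x)=\sum_{n=0}^\infty a_n\Gamma(\beta n+\alpha)x^n$. The coefficients $a_n$ may depend on $\alpha,\beta$.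
   Formalization: Added: φ(x)→∞ (for φ=1−e^{−x}, u=A=α=1 the formula fails) and A_Γ has positive radius of convergence (else the right side is undefined); the formula is shown on a half-plane Re s>σ and at every s with Re s>0 where both sides converge. *)

theory Defs
  imports "HOL-Analysis.Analysis"
begin

text \<open>
  Throughout, \<open>\<phi>'\<close> stands for the derivative of \<open>\<phi>\<close> on \<open>{0..}\<close>, one-sided at \<open>0\<close>;
  it is passed as a separate argument and pinned down by \<open>C1_on_halfline\<close>.
\<close>

definition C1_on_halfline :: "(real \<Rightarrow> real) \<Rightarrow> (real \<Rightarrow> real) \<Rightarrow> bool" where
  "C1_on_halfline \<phi> \<phi>' \<longleftrightarrow>
     (\<forall>x\<ge>0. (\<phi> has_real_derivative \<phi>' x) (at x within {0..})) \<and> continuous_on {0..} \<phi>'"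

definition piecewise_continuous_on :: "real \<Rightarrow> real \<Rightarrow> (real \<Rightarrow> real) \<Rightarrow> bool" where
  "piecewise_continuous_on a b f \<longleftrightarrow>
     (\<exists>S. finite S \<and> continuous_on ({a..b} - S) f) \<and>
     (\<forall>x\<in>{a<..b}. \<exists>l. (f \<longlongrightarrow> l) (at_left x)) \<and>
     (\<forall>x\<in>{a..<b}. \<exists>l. (f \<longlongrightarrow> l) (at_right x))"

definition phi_exponential_order :: "(real \<Rightarrow> real) \<Rightarrow> real \<Rightarrow> (real \<Rightarrow> real) \<Rightarrow> bool" where
  "phi_exponential_order \<phi> c f \<longleftrightarrow>
     c > 0 \<and> (\<exists>M>0. \<exists>X>0. \<forall>x>X. \<bar>f x\<bar> \<le> M * exp (c * \<phi> x))"

text \<open>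
  The Henstock--Kurzweil integral over \<open>{0..}\<close> includes the improper (possibly only
  conditionally convergent) integrals \<open>lim \<integral>\<^sub>0\<^sup>T\<close> as \<open>T\<close> tends to infinity, so
  \<open>has_gen_laplace \<phi> \<phi>' f s L\<close> says that the defining integral converges at \<open>s\<close> with value \<open>L\<close>.
\<close>

definition has_gen_laplace ::
  "(real \<Rightarrow> real) \<Rightarrow> (real \<Rightarrow> real) \<Rightarrow> (real \<Rightarrow> complex) \<Rightarrow> complex \<Rightarrow> complex \<Rightarrow> bool" where
  "has_gen_laplace \<phi> \<phi>' f s L \<longleftrightarrow>
     ((\<lambda>x. exp (- s * of_real (\<phi> x)) * of_real (\<phi>' x) * f x) has_integral L) {0..}"

text \<open>
  \<open>A\<close> is the sum function of the analytic kernel. Complex powers of the non-negative real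
  \<open>\<phi> x - \<phi> t\<close> are given by \<open>powr\<close> on \<open>complex\<close> (principal branch, \<open>0 powr z = 0\<close>).
\<close>

definition gen_frac_integral ::
  "(real \<Rightarrow> real) \<Rightarrow> (real \<Rightarrow> real) \<Rightarrow> complex \<Rightarrow> complex \<Rightarrow> (complex \<Rightarrow> complex) \<Rightarrow>
   (real \<Rightarrow> real) \<Rightarrow> real \<Rightarrow> complex" where
  "gen_frac_integral \<phi> \<phi>' \<alpha> \<beta> A u x =
     integral {0..x} (\<lambda>t. of_real (\<phi>' t) * of_real (\<phi> x - \<phi> t) powr (\<alpha> - 1) *
                          A (of_real (\<phi> x - \<phi> t) powr \<beta>) * of_real (u t))"

definition gamma_coeff :: "(nat \<Rightarrow> complex) \<Rightarrow> complex \<Rightarrow> complex \<Rightarrow> nat \<Rightarrow> complex" where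
  "gamma_coeff a \<alpha> \<beta> n = a n * Gamma (\<beta> * of_nat n + \<alpha>)"

definition transformed_kernel :: "(nat \<Rightarrow> complex) \<Rightarrow> complex \<Rightarrow> complex \<Rightarrow> complex \<Rightarrow> complex" where
  "transformed_kernel a \<alpha> \<beta> z = (\<Sum>n. gamma_coeff a \<alpha> \<beta> n * z ^ n)"

end

(*
  With respect to the measure phi'(t) dt on [0, oo), whose image under phi is Lebesgue measure on
  [0, oo), the fractional integral is the convolution of u with the kernel y^(alpha - 1) A(y^beta).
  For large real s everything converges absolutely: the product formula for Gamma gives
  Gamma (Re z) <= C^(1 + Re z) |Gamma z| on a sector around the positive axis, so a positive radius of
  convergence of A_Gamma controls the growth of A although beta is complex. Fubini's theorem and
  termwise integration of the kernel then give the formula for large real s.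

  If a Laplace integral converges (possibly conditionally) at s0, integration by parts shows that it
  converges to a holomorphic function on Re s > Re s0, with an Abel-type limit at s0. The region
  where moreover |s^(-beta)| is less than the radius of convergence of A_Gamma is connected, so the
  formula extends to it by analytic continuation, and to s0 itself by Abel's theorem along the ray
  (1 + t) s0, on which both the integrals and the power series stay in Stolz angles.
*)
theory Submission
  imports Defs "HOL-Complex_Analysis.Complex_Analysis"
begin

text \<open>Convergence in \<open>has_gen_laplace\<close> may be merely conditional, whereas Fubini
  and termwise integration need absolute convergence; hence the formula is not proved directly at a
  given point but carried there from large real arguments. The substitution y = \<phi>(x) is
  performed on measures because \<phi> may be constant on intervals and then has no inverse. For
  complex \<beta> a bound on |s^(-\<beta>)| does not cut out a half-plane, since this modulus also
  depends on arg s; the condition is, however, stable under s -> l s with l \<ge> 1. This also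
  dictates the ray used at s0: on s = (1 + t) s0 the difference s - s0 = t s0 has a fixed argument,
  so |s - s0| / Re (s - s0) is constant, and s^(-\<beta>) is s0^(-\<beta>) times (1 + t)^(-\<beta>),
  a factor q with |1 - q| \<le> (|\<beta>| / Re \<beta>) (1 - |q|). The first fact serves the two
  integrals, the second the power series, whose argument s0^(-\<beta>) may lie on the circle of
  convergence.\<close>

section \<open>Gamma on a sector, and Abel's theorem in Stolz angles\<close>

text \<open>Each term after the first is compared with a telescoping difference; the term
  \<open>k = 0\<close> is kept exactly. Dropping the last summand leaves a bound independent of
  \<open>n\<close>.\<close>

lemma sum_inverse_square_shift_le:
  fixes x :: real
  assumes "x > 0"
  shows "(\<Sum>k<Suc n. 1 / (x + real k)\<^sup>2) \<le> 1 / x\<^sup>2 + 1 / x - 1 / (x + real n)"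
proof (induction n)
  case (Suc n)
  have "1 / (x + real (Suc n))\<^sup>2 \<le> 1 / ((x + real n) * (x + real (Suc n)))"
    unfolding power2_eq_square using assms
    by (intro divide_left_mono mult_right_mono mult_pos_pos) auto
  also have "\<dots> = 1 / (x + real n) - 1 / (x + real (Suc n))"
    using assms by (simp add: divide_simps add_pos_nonneg)
  finally show ?case using Suc.IH by (simp del: of_nat_Suc)
qed (use assms in simp)

text \<open>Factor by factor, with x = Re z and y = Im z: |x + k + iy| = (x + k) sqrt(1 + y^2 / (x +
  k)^2), and 1 + h \<le> exp h under the root contributes y^2 / (2 (x + k)^2) to the
  exponent.\<close>

lemma norm_pochhammer_le:
  fixes z :: complex
  assumes "Re z > 0"
  shows "norm (pochhammer z n) \<le>
    pochhammer (Re z) n * exp ((Im z)\<^sup>2 / 2 * (\<Sum>k<n. 1 / (Re z + real k)\<^sup>2))"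
proof (induction n)
  case (Suc n)
  let ?x = "Re z + real n" and ?y = "Im z"
  have x: "?x > 0" using assms by simp
  have "norm (z + of_nat n) = sqrt (?x\<^sup>2 + ?y\<^sup>2)" by (simp add: cmod_def)
  also have "\<dots> \<le> ?x * exp (?y\<^sup>2 / 2 * (1 / ?x\<^sup>2))"
  proof (rule real_le_lsqrt)
    have "?x\<^sup>2 + ?y\<^sup>2 = ?x\<^sup>2 * (1 + ?y\<^sup>2 * (1 / ?x\<^sup>2))" using x by (simp add: field_simps)
    also have "\<dots> \<le> ?x\<^sup>2 * exp (?y\<^sup>2 * (1 / ?x\<^sup>2))"
      by (intro mult_left_mono exp_ge_add_one_self) auto
    also have "\<dots> = (?x * exp (?y\<^sup>2 / 2 * (1 / ?x\<^sup>2)))\<^sup>2"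
      by (simp add: power_mult_distrib flip: exp_double)
    finally show "?x\<^sup>2 + ?y\<^sup>2 \<le> (?x * exp (?y\<^sup>2 / 2 * (1 / ?x\<^sup>2)))\<^sup>2" .
  qed (use x in auto)
  finally have *: "norm (z + of_nat n) \<le> ?x * exp (?y\<^sup>2 / 2 * (1 / ?x\<^sup>2))" .
  have "norm (pochhammer z (Suc n)) = norm (pochhammer z n) * norm (z + of_nat n)"
    by (simp add: pochhammer_Suc norm_mult)
  also have "\<dots> \<le> (pochhammer (Re z) n * exp (?y\<^sup>2 / 2 * (\<Sum>k<n. 1 / (Re z + real k)\<^sup>2)))
      * (?x * exp (?y\<^sup>2 / 2 * (1 / ?x\<^sup>2)))"
    using assms by (intro mult_mono Suc.IH *) (auto intro!: mult_nonneg_nonneg pochhammer_nonneg)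
  also have "\<dots> = pochhammer (Re z) (Suc n) * exp (?y\<^sup>2 / 2 * (\<Sum>k<Suc n. 1 / (Re z + real k)\<^sup>2))"
    by (simp add: pochhammer_Suc distrib_left exp_add mult_ac)
  finally show ?case .
qed simp

text \<open>In \<open>Gamma_series\<close> the Pochhammer symbol is the denominator and the modulus
  of the numerator depends on Re z only, so an upper bound for the former bounds |Gamma z| from
  below. With x = Re z the exponent is at most (M x)^2 / 2 (1 / x^2 + 1 / x) = M^2 / 2 (1 + x),
  uniformly in the index of the sequence. The loss is exponential in Re z, hence only geometric
  along an arithmetic progression.\<close>

lemma Gamma_Re_le_norm_Gamma:
  fixes z :: complex
  assumes z: "Re z > 0" and M: "\<bar>Im z\<bar> \<le> M * Re z"
  shows "Gamma (Re z) \<le> exp (M\<^sup>2 / 2 * (1 + Re z)) * norm (Gamma z)"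
proof (rule LIMSEQ_le)
  define x where "x = Re z"
  define C where "C = exp (M\<^sup>2 / 2 * (1 + x))"
  show "Gamma_series (Re z) \<longlonglongrightarrow> Gamma (Re z)" by (rule Gamma_series_LIMSEQ)
  show "(\<lambda>n. exp (M\<^sup>2 / 2 * (1 + Re z)) * norm (Gamma_series z n)) \<longlonglongrightarrow>
      exp (M\<^sup>2 / 2 * (1 + Re z)) * norm (Gamma z)"
    by (intro tendsto_intros)
  have "Gamma_series x n \<le> C * norm (Gamma_series z n)" for n
  proof -
    have x: "x > 0" using z by (simp add: x_def)
    have M': "(Im z)\<^sup>2 \<le> M\<^sup>2 * x\<^sup>2"       using power_mono[OF M, of 2] by (simp add: x_def power_mult_distrib)
    have pz: "pochhammer z (n+1) \<noteq> 0"
      using z by (auto simp: pochhammer_eq_0_iff)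
    have "(\<Sum>k<Suc n. 1 / (x + real k)\<^sup>2) \<le> 1 / x\<^sup>2 + 1 / x"
    proof -
      have "1 / (x + real n) \<ge> 0" using x by simp
      with sum_inverse_square_shift_le[OF x, of n] show ?thesis by linarith
    qed
    hence "(Im z)\<^sup>2 / 2 * (\<Sum>k<Suc n. 1 / (x + real k)\<^sup>2) \<le> (M\<^sup>2 * x\<^sup>2) / 2 * (1 / x\<^sup>2 + 1 / x)"
      using M' by (intro mult_mono) (auto intro!: sum_nonneg simp del: sum.lessThan_Suc)
    also have "\<dots> = M\<^sup>2 / 2 * (1 + x)" using x by (simp add: field_simps power2_eq_square)
    finally have "exp ((Im z)\<^sup>2 / 2 * (\<Sum>k<Suc n. 1 / (x + real k)\<^sup>2)) \<le> C" by (simp add: C_def)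
    hence "pochhammer x (n+1) * exp ((Im z)\<^sup>2 / 2 * (\<Sum>k<Suc n. 1 / (x + real k)\<^sup>2)) \<le> pochhammer x (n+1) * C"
      using x by (intro mult_left_mono) (auto intro!: pochhammer_nonneg)
    with norm_pochhammer_le[OF z, of "n+1"] have *: "norm (pochhammer z (n+1)) \<le> pochhammer x (n+1) * C"
      by (simp add: x_def)
    have px: "pochhammer x (n+1) > 0" using x by (intro pochhammer_pos)
    have "Gamma_series x n = fact n * exp (x * ln (real n)) / pochhammer x (n+1)"
      by (simp add: Gamma_series_def)
    also have "\<dots> \<le> fact n * exp (x * ln (real n)) * (C / norm (pochhammer z (n+1)))"
      using * px pz by (simp add: divide_simps mult.commute mult_left_mono)
    also have "\<dots> = C * norm (Gamma_series z n)"
      by (simp add: Gamma_series_def norm_divide norm_mult x_def)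
    finally show ?thesis .
  qed
  thus "\<exists>N. \<forall>n\<ge>N. Gamma_series (Re z) n \<le> exp (M\<^sup>2 / 2 * (1 + Re z)) * norm (Gamma_series z n)"
    by (auto simp: x_def C_def)
qed

text \<open>Both sides are integrals over \<open>{0..\<tau>}\<close> of derivatives, and |\<beta>
  exp (- \<beta> x)| = |\<beta>| exp (- Re \<beta> x). For \<tau> = ln (1 + t) this is the Stolz
  condition for (1 + t)^(-\<beta>).\<close>

lemma norm_one_minus_exp_le:
  fixes \<beta> :: complex
  assumes "Re \<beta> > 0" "\<tau> \<ge> 0"
  shows "norm (1 - exp (- \<beta> * of_real \<tau>)) \<le> norm \<beta> / Re \<beta> * (1 - exp (- Re \<beta> * \<tau>))"
proof -
  have 1: "((\<lambda>x. \<beta> * exp (- \<beta> * of_real x)) has_integral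
      (- exp (- \<beta> * of_real \<tau>)) - (- exp (- \<beta> * of_real 0))) {0..\<tau>}"
    using assms(2)
    by (intro fundamental_theorem_of_calculus)
       (auto intro!: derivative_eq_intros has_vector_derivative_real_field)
  have 2: "((\<lambda>x. norm \<beta> * exp (- Re \<beta> * x)) has_integral
      (- (norm \<beta> / Re \<beta>) * exp (- Re \<beta> * \<tau>)) - (- (norm \<beta> / Re \<beta>) * exp (- Re \<beta> * 0))) {0..\<tau>}"
    using assms
    by (intro fundamental_theorem_of_calculus)
       (auto intro!: derivative_eq_intros simp: has_real_derivative_iff_has_vector_derivative[symmetric])
  have "norm (integral {0..\<tau>} (\<lambda>x. \<beta> * exp (- \<beta> * of_real x))) \<le>
     integral {0..\<tau>} (\<lambda>x. norm \<beta> * exp (- Re \<beta> * x))"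
    using 1 2 by (intro integral_norm_bound_integral) (auto simp: norm_mult)
  thus ?thesis unfolding integral_unique[OF 1] integral_unique[OF 2] by (simp add: algebra_simps)
qed

text \<open>Summation by parts in terms of the remainders \<open>D n\<close>. \<open>K\<close> is
  the aperture of the Stolz angle; a function \<open>q\<close> along a filter is used because the
  application approaches 1 on a curve.\<close>

lemma Abel_limit_Stolz:
  fixes b :: "nat \<Rightarrow> complex" and q :: "'a \<Rightarrow> complex"
  assumes b: "summable b" and q: "(q \<longlongrightarrow> 1) F"
    and stolz: "\<forall>\<^sub>F x in F. norm (q x) < 1 \<and> norm (1 - q x) \<le> K * (1 - norm (q x))"
  shows "((\<lambda>x. \<Sum>n. b n * q x ^ n) \<longlongrightarrow> suminf b) F"
proof -
  define D where "D n = (\<Sum>k\<le>n. b k) - suminf b" for n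
  have D0: "D \<longlonglongrightarrow> 0"
    unfolding D_def using summable_LIMSEQ'[OF b] by (auto intro: tendsto_eq_intros)
  then obtain B where B: "\<And>n. norm (D n) \<le> B"
    using convergent_imp_Bseq[OF convergentI[OF D0]] unfolding Bseq_def by blast
  have sumD: "summable (\<lambda>n. norm (D n * z ^ n))" if "norm z < 1" for z
  proof (rule summable_comparison_test')
    show "summable (\<lambda>n. B * norm z ^ n)" using that by (intro summable_mult summable_geometric) auto
    show "norm (norm (D n * z ^ n)) \<le> B * norm z ^ n" for n
      using B[of n] by (auto simp: norm_mult norm_power intro!: mult_right_mono)
  qed
  \<comment> \<open>Since \<open>b (Suc n) = D (Suc n) - D n\<close> and
    \<open>b 0 = D 0 + suminf b\<close>, the series in \<open>b\<close> becomes one in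
    \<open>D\<close> with a factor \<open>1 - z\<close> in front.\<close>
  have key: "(\<Sum>n. b n * z ^ n) - suminf b = (1 - z) * (\<Sum>n. D n * z ^ n)" if z: "norm z < 1" for z
  proof -
    note sD = summable_norm_cancel[OF sumD[OF z]]
    have sb: "summable (\<lambda>n. b n * z ^ n)"
      by (rule powser_inside[OF _ , of b 1]) (use b z in auto)
    have "(1 - z) * (\<Sum>n. D n * z ^ n) = (\<Sum>n. D n * z ^ n) - (\<Sum>n. D n * z ^ Suc n)"
      using suminf_mult[OF sD, of z] by (simp add: algebra_simps)
    also have "\<dots> = D 0 + (\<Sum>n. D (Suc n) * z ^ Suc n) - (\<Sum>n. D n * z ^ Suc n)"
      using suminf_split_head[OF sD] by simp
    also have "\<dots> =
        D 0 + (\<Sum>n. D (Suc n) * z ^ Suc n - D n * z ^ Suc n)"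
      using summable_mult[OF sD, of z] summable_ignore_initial_segment[OF sD, of 1]
      by (subst suminf_diff[symmetric]) (simp_all add: mult_ac)
    also have "(\<lambda>n. D (Suc n) * z ^ Suc n - D n * z ^ Suc n) = (\<lambda>n. b (Suc n) * z ^ Suc n)"
      by (auto simp: D_def algebra_simps)
    also have "D 0 + (\<Sum>n. b (Suc n) * z ^ Suc n) = (\<Sum>n. b n * z ^ n) - suminf b"
      using suminf_split_head[OF sb] by (simp add: D_def)
    finally show ?thesis ..
  qed
  have "((\<lambda>x. (\<Sum>n. b n * q x ^ n) - suminf b) \<longlongrightarrow> 0) F"
  proof (rule tendstoI)
    fix e :: real assume e: "e > 0"
    \<comment> \<open>The remainders from \<open>N\<close> on contribute at most \<epsilon> |1 - z|
      / (1 - |z|) \<le> |K| \<epsilon> \<le> e / 2; the first \<open>N\<close> contribute |1 - z|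
      \<open>S\<close>, which tends to 0. The added 1 avoids division by zero.\<close>
    define \<epsilon> where "\<epsilon> = e / (2 * (\<bar>K\<bar> + 1))"
    have eps: "\<epsilon> > 0" using e by (simp add: \<epsilon>_def)
    from D0 eps obtain N where N: "\<And>n. n \<ge> N \<Longrightarrow> norm (D n) < \<epsilon>"
      by (auto simp: LIMSEQ_iff)
    define S where "S = (\<Sum>n<N. norm (D n))"
    have S0: "S \<ge> 0" by (simp add: S_def sum_nonneg)
    have "((\<lambda>x. norm (1 - q x) * S) \<longlongrightarrow> norm (1 - 1 :: complex) * S) F"
      by (intro tendsto_intros q)
    hence "\<forall>\<^sub>F x in F. norm (1 - q x) * S < e / 2"
      using e by (intro order_tendstoD) auto
    with stolz show "\<forall>\<^sub>F x in F. dist ((\<Sum>n. b n * q x ^ n) - suminf b) 0 < e"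
    proof eventually_elim
      case (elim x)
      let ?z = "q x"
      have z: "norm ?z < 1" using elim by simp
      have "norm (\<Sum>n. D n * ?z ^ n) \<le> (\<Sum>n. norm (D n * ?z ^ n))"
        by (rule summable_norm[OF sumD[OF z]])
      also have "\<dots> \<le> (\<Sum>n. (if n < N then norm (D n) else 0) + \<epsilon> * norm ?z ^ n)"
      proof (intro suminf_le sumD z)
        show "summable (\<lambda>n. (if n < N then norm (D n) else 0) + \<epsilon> * norm ?z ^ n)"
          using z by (intro summable_add summable_mult summable_geometric summable_finite[of "{..<N}"]) auto
        fix n
        show "norm (D n * ?z ^ n) \<le> (if n < N then norm (D n) else 0) + \<epsilon> * norm ?z ^ n"
        proof (cases "n < N")
          case True
          have "norm (D n) * norm ?z ^ n \<le> norm (D n) * 1"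
            using z by (intro mult_left_mono power_le_one) auto
          moreover have "\<epsilon> * norm ?z ^ n \<ge> 0" using eps by simp
          ultimately show ?thesis using True by (simp add: norm_mult norm_power)
        qed (use N[of n] in \<open>auto simp: norm_mult norm_power intro!: mult_right_mono\<close>)
      qed
      also have "\<dots> = S + \<epsilon> / (1 - norm ?z)"
      proof (rule sums_unique[symmetric], rule sums_add)
        show "(\<lambda>n. if n < N then norm (D n) else 0) sums S"
          using sums_If_finite[of "\<lambda>n. n < N" "\<lambda>n. norm (D n)"] by (simp add: S_def lessThan_def)
        show "(\<lambda>n. \<epsilon> * norm ?z ^ n) sums (\<epsilon> / (1 - norm ?z))"
          using sums_mult[OF geometric_sums[of "norm ?z"], of \<epsilon>] z by simp
      qed
      finally have "norm (1 - ?z) * norm (\<Sum>n. D n * ?z ^ n) \<le> norm (1 - ?z) * (S + \<epsilon> / (1 - norm ?z))"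
        by (intro mult_left_mono) auto
      also have "\<dots> = norm (1 - ?z) * S + norm (1 - ?z) * (\<epsilon> / (1 - norm ?z))"
        by (simp add: distrib_left)
      also have "norm (1 - ?z) * (\<epsilon> / (1 - norm ?z)) \<le> (\<bar>K\<bar> * (1 - norm ?z)) * (\<epsilon> / (1 - norm ?z))"
      proof (rule mult_right_mono)
        have "K * (1 - norm ?z) \<le> \<bar>K\<bar> * (1 - norm ?z)" using z by (intro mult_right_mono) auto
        thus "norm (1 - ?z) \<le> \<bar>K\<bar> * (1 - norm ?z)" using elim by linarith
      qed (use eps z in auto)
      also have "\<dots> = \<bar>K\<bar> * \<epsilon>" using z by simp
      also have "\<dots> \<le> e / 2" using e by (simp add: \<epsilon>_def field_simps)
      finally show ?case using key[OF z] elim by (simp add: norm_mult)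
    qed
  qed
  thus ?thesis by (simp add: Lim_null[symmetric])
qed

section \<open>Laplace transform of the kernel\<close>

definition pow_kernel :: "complex \<Rightarrow> real \<Rightarrow> complex" where
  "pow_kernel z y = (if y > 0 then of_real y powr (z - 1) else 0)"

lemma pow_kernel_measurable [measurable]: "pow_kernel z \<in> borel_measurable borel"
proof -
  have "(\<lambda>y. indicator {0<..} y *\<^sub>R (complex_of_real y powr (z - 1))) \<in> borel_measurable borel"
    by (intro borel_measurable_continuous_on_indicator continuous_intros)
       (auto simp: complex_nonpos_Reals_iff)
  also have "(\<lambda>y. indicator {0<..} y *\<^sub>R (complex_of_real y powr (z - 1))) = pow_kernel z"
    by (auto simp: pow_kernel_def)
  finally show ?thesis .
qed

lemma norm_pow_kernel: "norm (pow_kernel z y) = Re (pow_kernel (of_real (Re z)) y)"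
proof (cases "y > 0")
  case True
  have "complex_of_real y powr (of_real (Re z) - 1) = complex_of_real y powr of_real (Re z - 1)" by simp
  also have "\<dots> = of_real (y powr (Re z - 1))" using True by (subst powr_of_real) auto
  finally show ?thesis using True by (simp add: pow_kernel_def norm_powr_real_powr)
qed (simp add: pow_kernel_def)

text \<open>The Gamma integral after rescaling. Integrability comes from the Gamma integrand with
  parameter \<open>s\<close>; the value is taken from parameter 1.\<close>

lemma
  assumes z: "Re z > 0" and s: "s > 0"
  shows integrable_laplace_pow_kernel: "integrable lborel (\<lambda>y. of_real (exp (- s * y)) * pow_kernel z y)"
    and integral_laplace_pow_kernel:
      "(\<integral>y. of_real (exp (- s * y)) * pow_kernel z y \<partial>lborel) = Gamma z * of_real s powr (- z)"
proof -
  have eq: "indicator {0<..} y *\<^sub>R (complex_of_real y powr (z - 1) / of_real (exp (c * y))) =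
      of_real (exp (- c * y)) * pow_kernel z y" for c y
    by (auto simp: pow_kernel_def indicator_def exp_minus field_simps)
  have int: "integrable lborel (\<lambda>y. of_real (exp (- c * y)) * pow_kernel z y)" if "c > 0" for c
  proof -
    from absolutely_integrable_Gamma_integral[OF z that]
    have "integrable lebesgue (\<lambda>y. of_real (exp (- c * y)) * pow_kernel z y)"
      unfolding set_integrable_def eq .
    thus ?thesis by (subst (asm) integrable_completion) measurable
  qed
  show "integrable lborel (\<lambda>y. of_real (exp (- s * y)) * pow_kernel z y)" by (rule int[OF s])
  have ai: "set_integrable lebesgue {0<..} (\<lambda>y. complex_of_real y powr (z - 1) / of_real (exp (1 * y)))"
    by (rule absolutely_integrable_Gamma_integral[OF z zero_less_one])
  have "Gamma z = integral {0<..} (\<lambda>y. complex_of_real y powr (z - 1) / of_real (exp (1 * y)))"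
    using Gamma_integral_complex'[OF z] by (simp add: integral_unique)
  also have "\<dots> = (\<integral>y. of_real (exp (- 1 * y)) * pow_kernel z y \<partial>lebesgue)"
    unfolding set_lebesgue_integral_eq_integral(2)[OF ai, symmetric] set_lebesgue_integral_def eq ..
  also have "\<dots> = (\<integral>y. of_real (exp (- 1 * y)) * pow_kernel z y \<partial>lborel)"
    by (rule integral_completion) measurable
  \<comment> \<open>Replacing y by s y: the kernel is homogeneous of degree z - 1 and the measure
    contributes one more factor s, together s^z.\<close>
  also have "\<dots> = \<bar>s\<bar> *\<^sub>R (\<integral>y. of_real (exp (- 1 * (0 + s * y))) * pow_kernel z (0 + s * y) \<partial>lborel)"
    by (rule lborel_integral_real_affine) (use s in auto)
  also have "(\<lambda>y. of_real (exp (- 1 * (0 + s * y))) * pow_kernel z (0 + s * y)) =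
      (\<lambda>y. of_real s powr (z - 1) * (of_real (exp (- s * y)) * pow_kernel z y))"
    using s by (auto simp: pow_kernel_def fun_eq_iff zero_less_mult_iff powr_times_real)
  finally have "Gamma z = (of_real s * of_real s powr (z - 1)) *
      (\<integral>y. of_real (exp (- s * y)) * pow_kernel z y \<partial>lborel)"
    using s by (simp add: scaleR_conv_of_real)
  moreover have "of_real s * of_real s powr (z - 1) = of_real s powr z"
    using s by (simp add: powr_diff)
  moreover have "of_real s powr z \<noteq> (0::complex)" using s by simp
  ultimately show "(\<integral>y. of_real (exp (- s * y)) * pow_kernel z y \<partial>lborel) = Gamma z * of_real s powr (- z)"
    by (simp add: powr_minus field_simps)
qed

text \<open>The modulus of the kernel for \<open>z\<close> is the kernel for \<open>Re z\<close>, so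
  the previous integral applies at a real parameter. This is why absolute convergence is governed by
  Gamma (Re z) and not by |Gamma z|.\<close>

lemma integral_norm_laplace_pow_kernel:
  assumes z: "Re z > 0" and s: "s > 0"
  shows "(\<integral>y. norm (of_real (exp (- s * y)) * pow_kernel z y) \<partial>lborel) = Gamma (Re z) * s powr (- Re z)"
proof -
  let ?r = "complex_of_real (Re z)"
  have "(\<integral>y. norm (of_real (exp (- s * y)) * pow_kernel z y) \<partial>lborel) =
      (\<integral>y. Re (of_real (exp (- s * y)) * pow_kernel ?r y) \<partial>lborel)"
    by (intro Bochner_Integration.integral_cong refl) (simp add: norm_mult norm_pow_kernel)
  also have "\<dots> = Re (\<integral>y. of_real (exp (- s * y)) * pow_kernel ?r y \<partial>lborel)"
    using integrable_laplace_pow_kernel[of ?r s] z s by (intro integral_Re) simp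
  also have "\<dots> = Re (Gamma ?r * of_real s powr (- ?r))"
    using integral_laplace_pow_kernel[of ?r s] z s by simp
  also have "\<dots> = Gamma (Re z) * s powr (- Re z)"
    using s by (simp add: Gamma_complex_of_real powr_of_real flip: of_real_minus)
  finally show ?thesis .
qed

text \<open>The value 0 at y = 0 agrees with the convention \<open>0 powr z = 0\<close> in
  \<open>gen_frac_integral\<close>, so the two integrands coincide everywhere, even where \<phi> is
  constant to the left of \<open>x\<close>.\<close>

definition series_kernel :: "complex \<Rightarrow> complex \<Rightarrow> (complex \<Rightarrow> complex) \<Rightarrow> real \<Rightarrow> complex" where
  "series_kernel \<alpha> \<beta> A y = (if y > 0 then of_real y powr (\<alpha> - 1) * A (of_real y powr \<beta>) else 0)"

text \<open>Termwise integration: the n-th term of the kernel is \<open>a n\<close> times the power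
  kernel with parameter \<beta> n + \<alpha>, and \<open>sum\<close> says exactly that the L1 norms
  of the weighted terms are summable.\<close>

lemma
  fixes a :: "nat \<Rightarrow> complex"
  assumes \<alpha>: "Re \<alpha> > 0" and \<beta>: "Re \<beta> > 0" and A: "\<And>z. (\<lambda>n. a n * z ^ n) sums A z" and s: "s > 0"
    and sum: "summable (\<lambda>n. norm (a n) * Gamma (Re (\<beta> * of_nat n + \<alpha>)) * s powr (- Re (\<beta> * of_nat n + \<alpha>)))"
  shows integrable_laplace_series_kernel:
      "integrable lborel (\<lambda>y. of_real (exp (- s * y)) * series_kernel \<alpha> \<beta> A y)"
    and integral_laplace_series_kernel:
      "(\<integral>y. of_real (exp (- s * y)) * series_kernel \<alpha> \<beta> A y \<partial>lborel) =
        of_real s powr (- \<alpha>) * transformed_kernel a \<alpha> \<beta> (of_real s powr (- \<beta>))"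
proof -
  define e where "e n = \<beta> * of_nat n + \<alpha>" for n
  have e: "Re (e n) > 0" for n using \<alpha> \<beta> by (simp add: e_def add_nonneg_pos)
  define f where "f n y = a n * (of_real (exp (- s * y)) * pow_kernel (e n) y)" for n y
  have fint: "integrable lborel (f n)" for n
    unfolding f_def by (intro integrable_mult_right integrable_laplace_pow_kernel e s)
  have fnorm: "(\<integral>y. norm (f n y) \<partial>lborel) = norm (a n) * Gamma (Re (e n)) * s powr (- Re (e n))" for n
    using integral_norm_laplace_pow_kernel[OF e s, of n]
    by (simp add: f_def norm_mult[of "a n"] mult.assoc)
  have pw: "a n * pow_kernel (e n) y = of_real y powr (\<alpha> - 1) * (a n * (of_real y powr \<beta>) ^ n)"
    if "y > 0" for n y
    using that
    by (simp add: pow_kernel_def e_def powr_def exp_of_nat_mult[symmetric] mult_exp_exp algebra_simps)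
  have fsums: "(\<lambda>n. f n y) sums (of_real (exp (- s * y)) * series_kernel \<alpha> \<beta> A y)" for y
  proof (cases "y > 0")
    case True
    have "(\<lambda>n. of_real (exp (- s * y)) * (of_real y powr (\<alpha> - 1) * (a n * (of_real y powr \<beta>) ^ n)))
        sums (of_real (exp (- s * y)) * (of_real y powr (\<alpha> - 1) * A (of_real y powr \<beta>)))"
      by (intro sums_mult A)
    also have "(\<lambda>n. of_real (exp (- s * y)) * (of_real y powr (\<alpha> - 1) * (a n * (of_real y powr \<beta>) ^ n))) =
        (\<lambda>n. f n y)"
      unfolding pw[OF True, symmetric] f_def by (simp add: mult_ac)
    finally show ?thesis using True by (simp add: series_kernel_def)
  qed (simp add: f_def pow_kernel_def series_kernel_def)
  have nsum: "summable (\<lambda>n. norm (f n y))" for y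
  proof (cases "y > 0")
    case True
    have "summable (\<lambda>n. norm (a n * (of_real y powr \<beta>) ^ n))"
    proof (rule powser_insidea)
      \<comment> \<open>The series converges everywhere, in particular at a point of modulus one
        larger; this yields absolute convergence at y^\<beta>.\<close>
      show "summable (\<lambda>n. a n * (of_real (norm (of_real y powr \<beta>) + 1)) ^ n)"
        using A by (rule sums_summable)
      show "norm (of_real y powr \<beta>) < norm (complex_of_real (norm (of_real y powr \<beta>) + 1))"
        unfolding norm_of_real by (simp add: abs_if not_less)
    qed
    hence "summable (\<lambda>n. norm (of_real (exp (- s * y)) * of_real y powr (\<alpha> - 1)) *
        norm (a n * (of_real y powr \<beta>) ^ n))"
      by (rule summable_mult)
    also have "(\<lambda>n. norm (of_real (exp (- s * y)) * of_real y powr (\<alpha> - 1)) *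
        norm (a n * (of_real y powr \<beta>) ^ n)) = (\<lambda>n. norm (f n y))"
    proof
      fix n
      have "f n y = of_real (exp (- s * y)) * (a n * pow_kernel (e n) y)" by (simp add: f_def)
      thus "norm (of_real (exp (- s * y)) * of_real y powr (\<alpha> - 1)) *
        norm (a n * (of_real y powr \<beta>) ^ n) = norm (f n y)"
        unfolding pw[OF True] by (simp add: norm_mult mult_ac)
    qed
    finally show ?thesis .
  qed (simp add: f_def pow_kernel_def)
  have isum: "summable (\<lambda>n. \<integral>y. norm (f n y) \<partial>lborel)"
    unfolding fnorm using sum by (simp add: e_def)
  have eq: "(\<lambda>y. \<Sum>n. f n y) = (\<lambda>y. of_real (exp (- s * y)) * series_kernel \<alpha> \<beta> A y)"
    using fsums by (auto simp: fun_eq_iff sums_iff)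
  show "integrable lborel (\<lambda>y. of_real (exp (- s * y)) * series_kernel \<alpha> \<beta> A y)"
    unfolding eq[symmetric] by (rule integrable_suminf[OF fint AE_I2[OF nsum] isum])
  have "(\<lambda>n. integral\<^sup>L lborel (f n)) sums (\<integral>y. (\<Sum>n. f n y) \<partial>lborel)"
    by (rule sums_integral[OF fint AE_I2[OF nsum] isum])
  moreover have "integral\<^sup>L lborel (f n) =
      of_real s powr (- \<alpha>) * (gamma_coeff a \<alpha> \<beta> n * (of_real s powr (- \<beta>)) ^ n)" for n
  proof -
    have "integral\<^sup>L lborel (f n) = a n * (Gamma (e n) * of_real s powr (- e n))"
      unfolding f_def by (simp only: integral_mult_right_zero integral_laplace_pow_kernel[OF e s])
    also have "of_real s powr (- e n) = of_real s powr (- \<alpha>) * (of_real s powr (- \<beta>)) ^ n"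
      using s by (simp add: e_def powr_def exp_of_nat_mult[symmetric] mult_exp_exp algebra_simps)
    finally show ?thesis by (simp add: gamma_coeff_def e_def mult_ac)
  qed
  ultimately have sums: "(\<lambda>n. of_real s powr (- \<alpha>) * (gamma_coeff a \<alpha> \<beta> n * (of_real s powr (- \<beta>)) ^ n)) sums
      (\<integral>y. of_real (exp (- s * y)) * series_kernel \<alpha> \<beta> A y \<partial>lborel)"
    by (simp add: eq)
  have "complex_of_real s powr (- \<alpha>) \<noteq> 0" using s by simp
  from summable_mult_D[OF sums_summable[OF sums] this]
  have "summable (\<lambda>n. gamma_coeff a \<alpha> \<beta> n * (of_real s powr (- \<beta>)) ^ n)" .
  from trans[OF sums_unique[OF sums] suminf_mult[OF this, of "of_real s powr (- \<alpha>)"]]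
  show "(\<integral>y. of_real (exp (- s * y)) * series_kernel \<alpha> \<beta> A y \<partial>lborel) =
        of_real s powr (- \<alpha>) * transformed_kernel a \<alpha> \<beta> (of_real s powr (- \<beta>))"
    unfolding transformed_kernel_def .
qed

section \<open>Improper integrals, and Fubini on a triangle\<close>

text \<open>The integral over an unbounded set is a limit over boxes containing large balls. Such a
  box has left end point at most 0, where the integrand is cut off, so only the right end point
  matters.\<close>

lemma has_integral_atLeast_iff_tendsto:
  fixes f :: "real \<Rightarrow> 'a::banach"
  assumes int: "\<And>T. f integrable_on {0..T}"
  shows "(f has_integral I) {0..} \<longleftrightarrow> ((\<lambda>T. integral {0..T} f) \<longlongrightarrow> I) at_top"
proof -
  have Int: "{0..} \<inter> cbox a b = {max 0 a..b}" for a b :: real by auto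
  have 1: "(\<lambda>x. if x \<in> {0..} then f x else 0) integrable_on cbox a b" for a b
    unfolding integrable_restrict_Int Int
    by (rule integrable_on_subinterval[OF int[of b]]) auto
  \<comment> \<open>The ball is open and misses its end points; passing to the closure gives
    \<open>b \<ge> B\<close>.\<close>
  have ballsub: "ball 0 B \<subseteq> cbox a b \<Longrightarrow> B > 0 \<Longrightarrow> a \<le> 0 \<and> b \<ge> B" for a b B :: real
  proof -
    assume s: "ball 0 B \<subseteq> cbox a b" and B: "B > 0"
    have "cball (0::real) B = closure (ball 0 B)" using B by simp
    also have "\<dots> \<subseteq> cbox a b" using s by (intro closure_minimal) auto
    finally have "cball 0 B \<subseteq> cbox a b" .
    moreover have "0 \<in> cball 0 B" "B \<in> cball 0 B" using B by auto
    ultimately show ?thesis by (auto simp: subset_eq)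
  qed
  have 2: "integral (cbox a b) (\<lambda>x. if x \<in> {0..} then f x else 0) = integral {0..b} f"
    if "a \<le> 0" for a b
    unfolding integral_restrict_Int Int using that by simp
  have 3: "norm (integral (cbox a b) (\<lambda>x. if x \<in> {0..} then f x else 0) - I) < e \<longleftrightarrow>
      norm (integral {0..b} f - I) < e" if "B > 0" "ball 0 B \<subseteq> cbox a b" for a b B e
    using ballsub[OF that(2,1)] by (simp only: 2)
  have "(f has_integral I) {0..} \<longleftrightarrow>
      (\<forall>e>0. \<exists>B>0. \<forall>a b. ball 0 B \<subseteq> cbox a b \<longrightarrow>
        norm (integral (cbox a b) (\<lambda>x. if x \<in> {0..} then f x else 0) - I) < e)"
    unfolding has_integral_alt'[of f I] using 1 by blast
  also have "\<dots> \<longleftrightarrow>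
      (\<forall>e>0. \<exists>B>0. \<forall>a b. ball 0 B \<subseteq> cbox a b \<longrightarrow> norm (integral {0..b} f - I) < e)"
    by (intro all_cong1 imp_cong refl ex_cong1 conj_cong) (erule (1) 3)
  also have "\<dots> \<longleftrightarrow> ((\<lambda>T. integral {0..T} f) \<longlongrightarrow> I) at_top"
  proof safe
    assume *: "\<forall>e>0. \<exists>B>0. \<forall>a b. ball 0 B \<subseteq> cbox a b \<longrightarrow> norm (integral {0..b} f - I) < e"
    show "((\<lambda>T. integral {0..T} f) \<longlongrightarrow> I) at_top"
    proof (rule tendstoI)
      fix e :: real assume "e > 0"
      with * obtain B where B: "B > 0" "\<And>a b. ball 0 B \<subseteq> cbox a b \<Longrightarrow> norm (integral {0..b} f - I) < e"
        by blast
      have "norm (integral {0..T} f - I) < e" if "T \<ge> B" for T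
        by (rule B(2)[of "-B" T]) (use that in \<open>auto simp: dist_real_def\<close>)
      thus "\<forall>\<^sub>F T in at_top. dist (integral {0..T} f) I < e"
        unfolding eventually_at_top_linorder dist_norm by blast
    qed
  next
    fix e :: real
    assume *: "((\<lambda>T. integral {0..T} f) \<longlongrightarrow> I) at_top" and "e > 0"
    then obtain B where B: "\<And>T. T \<ge> B \<Longrightarrow> norm (integral {0..T} f - I) < e"
      unfolding tendsto_iff eventually_at_top_linorder dist_norm by blast
    show "\<exists>B>0. \<forall>a b. ball 0 B \<subseteq> cbox a b \<longrightarrow> norm (integral {0..b} f - I) < e"
    proof (intro exI[of _ "max 1 B"] conjI allI impI)
      fix a b :: real assume "ball 0 (max 1 B) \<subseteq> cbox a b"
      from ballsub[OF this] show "norm (integral {0..b} f - I) < e" by (intro B) auto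
    qed auto
  qed
  finally show ?thesis .
qed

text \<open>Fubini on the set x \<le> y, where the integrand is dominated by the integrable product
  on the plane. Tails of \<open>p\<close> are exchanged for primitives of \<open>g\<close>: partial
  integration without differentiating either primitive.\<close>

lemma integral_triangle_swap:
  fixes g p :: "real \<Rightarrow> complex"
  assumes g: "integrable lborel g" and p: "integrable lborel p"
  shows "(\<integral>x. g x * (\<integral>y. indicator {x..} y *\<^sub>R p y \<partial>lborel) \<partial>lborel) =
         (\<integral>y. p y * (\<integral>x. indicator {..y} x *\<^sub>R g x \<partial>lborel) \<partial>lborel)"
proof -
  note [measurable] = borel_measurable_integrable[OF g] borel_measurable_integrable[OF p]
  have 1: "integrable (lborel \<Otimes>\<^sub>M lborel) (\<lambda>(x, y). g x * p y)"
  proof (rule lborel_pair.Fubini_integrable)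
    show "integrable lborel (\<lambda>x. \<integral>y. norm (case (x, y) of (x, y) \<Rightarrow> g x * p y) \<partial>lborel)"
      using g by (simp add: norm_mult)
  qed (use p in auto)
  have 2: "integrable (lborel \<Otimes>\<^sub>M lborel) (\<lambda>(x, y). indicator {x..} y *\<^sub>R (g x * p y))"
  proof (rule Bochner_Integration.integrable_bound[OF 1])
    show "(\<lambda>(x, y). indicator {x..} y *\<^sub>R (g x * p y)) \<in> borel_measurable (lborel \<Otimes>\<^sub>M lborel)"
      unfolding indicator_def atLeast_iff by measurable
  qed (auto simp: indicator_def)
  have 3: "(\<lambda>x. indicator {x..} y *\<^sub>R (g x * p y)) = (\<lambda>x. p y * (indicator {..y} x *\<^sub>R g x))" for y
    by (auto simp: indicator_def)
  have 4: "(\<lambda>y. indicator {x..} y *\<^sub>R (g x * p y)) = (\<lambda>y. g x * (indicator {x..} y *\<^sub>R p y))" for x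
    by (auto simp: indicator_def)
  from lborel_pair.Fubini_integral[OF 2] show ?thesis
    unfolding 3 4 integral_mult_right_zero by (rule sym)
qed

section \<open>Substitution measures and generalised Laplace transforms\<close>

text \<open>Two-sided derivatives on the whole line avoid one-sided arguments at 0. Unboundedness
  makes the image of \<open>{0..}\<close> all of \<open>{0..}\<close>.\<close>

locale c1_substitution =
  fixes \<phi> \<phi>' :: "real \<Rightarrow> real"
  assumes deriv: "(\<phi> has_real_derivative \<phi>' x) (at x)"
    and cont_deriv: "continuous_on UNIV \<phi>'"
    and deriv_nonneg: "\<phi>' x \<ge> 0"
    and zero [simp]: "\<phi> 0 = 0"
    and unbounded: "filterlim \<phi> at_top at_top"
begin

lemma mono: "x \<le> y \<Longrightarrow> \<phi> x \<le> \<phi> y"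
  by (rule DERIV_nonneg_imp_nondecreasing[of x y \<phi>]) (use deriv deriv_nonneg in blast)+

lemma nonneg: "x \<ge> 0 \<Longrightarrow> \<phi> x \<ge> 0"
  using mono[of 0 x] by simp

lemma cont: "continuous_on S \<phi>"
  by (rule DERIV_continuous_on) (rule has_field_derivative_at_within[OF deriv])

lemma measurable_phi [measurable]: "\<phi> \<in> borel_measurable borel"
  using cont by (rule borel_measurable_continuous_onI)

lemma measurable_phi' [measurable]: "\<phi>' \<in> borel_measurable borel"
  using cont_deriv by (rule borel_measurable_continuous_onI)

definition \<mu> :: "real measure" where
  "\<mu> = density lborel (\<lambda>x. ennreal (indicator {0..} x * \<phi>' x))"

lemma sets_mu [simp, measurable_cong]: "sets \<mu> = sets borel"
  and space_mu [simp]: "space \<mu> = UNIV"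
  by (simp_all add: \<mu>_def)

lemma integrable_mu_iff:
  fixes f :: "real \<Rightarrow> 'a :: {banach, second_countable_topology}"
  assumes [measurable]: "f \<in> borel_measurable borel"
  shows "integrable \<mu> f \<longleftrightarrow> integrable lborel (\<lambda>x. (indicator {0..} x * \<phi>' x) *\<^sub>R f x)"
  unfolding \<mu>_def by (rule integrable_density) (auto simp: deriv_nonneg)

lemma integral_mu_eq:
  fixes f :: "real \<Rightarrow> 'a :: {banach, second_countable_topology}"
  assumes [measurable]: "f \<in> borel_measurable borel"
  shows "integral\<^sup>L \<mu> f = (\<integral>x. (indicator {0..} x * \<phi>' x) *\<^sub>R f x \<partial>lborel)"
  unfolding \<mu>_def by (rule integral_density) (auto simp: deriv_nonneg)

lemma sigma_finite_mu: "sigma_finite_measure \<mu>"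
  unfolding \<mu>_def by (subst sigma_finite_measure.sigma_finite_iff_density_finite[OF sigma_finite_lborel]) auto

text \<open>Substitution on each \<open>{0..n}\<close>, whose image is \<open>{0..\<phi> n}\<close>,
  followed by monotone convergence on both sides; these images exhaust the half-line because \<phi>
  is unbounded. Intervals on which \<phi> is constant do no harm: \<mu> gives them no mass.\<close>

lemma distr_mu: "distr \<mu> borel \<phi> = density lborel (indicator {0..})"
proof (rule measure_eqI)
  fix A assume "A \<in> sets (distr \<mu> borel \<phi>)"
  hence [measurable]: "A \<in> sets borel" by simp
  let ?f = "\<lambda>n y. indicator A y * (indicator {0..\<phi> (real n)} y :: ennreal)"
  let ?g = "\<lambda>n x. indicator A (\<phi> x) * ennreal (\<phi>' x) * indicator {0..real n} x"
  have eq: "(\<integral>\<^sup>+y. ?f n y \<partial>lborel) = (\<integral>\<^sup>+x. ?g n x \<partial>lborel)" for n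
  proof -
    have "(\<integral>\<^sup>+y. ?f n y \<partial>lborel) = (\<integral>\<^sup>+y. ennreal (indicator A y * indicator {\<phi> 0..\<phi> (real n)} y) \<partial>lborel)"
      by (intro nn_integral_cong) (auto simp: indicator_def)
    also have "\<dots> = (\<integral>\<^sup>+x. ennreal (indicator A (\<phi> x) * \<phi>' x * indicator {0..real n} x) \<partial>lborel)"
      by (rule nn_integral_substitution)
         (auto intro!: deriv deriv_nonneg continuous_on_subset[OF cont_deriv] simp: set_borel_measurable_def)
    also have "\<dots> = (\<integral>\<^sup>+x. ?g n x \<partial>lborel)"
      by (intro nn_integral_cong) (auto simp: indicator_def)
    finally show ?thesis .
  qed
  have "(\<lambda>n. \<integral>\<^sup>+y. ?f n y \<partial>lborel) \<longlonglongrightarrow> (\<integral>\<^sup>+y. indicator A y * indicator {0..} y \<partial>lborel)"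
  proof (rule nn_integral_LIMSEQ)
    show "incseq ?f"
      by (auto simp: incseq_def le_fun_def indicator_def intro: order.trans[OF _ mono])
    fix y :: real
    have "\<forall>\<^sub>F n in sequentially. \<phi> (real n) \<ge> y"
      using filterlim_compose[OF unbounded filterlim_real_sequentially]
      by (auto simp: filterlim_at_top)
    thus "(\<lambda>n. ?f n y) \<longlonglongrightarrow> indicator A y * indicator {0..} y"
      by (intro tendsto_eventually, eventually_elim) (auto simp: indicator_def)
  qed auto
  moreover have "(\<lambda>n. \<integral>\<^sup>+x. ?g n x \<partial>lborel) \<longlonglongrightarrow>
      (\<integral>\<^sup>+x. ennreal (indicator {0..} x * \<phi>' x) * indicator A (\<phi> x) \<partial>lborel)"
  proof (rule nn_integral_LIMSEQ)
    show "incseq ?g" by (auto simp: incseq_def le_fun_def indicator_def)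
    fix x :: real
    have "\<forall>\<^sub>F n in sequentially. real n \<ge> x" by real_asymp
    thus "(\<lambda>n. ?g n x) \<longlonglongrightarrow> ennreal (indicator {0..} x * \<phi>' x) * indicator A (\<phi> x)"
      by (intro tendsto_eventually, eventually_elim) (auto simp: indicator_def)
  qed auto
  ultimately have "(\<integral>\<^sup>+y. indicator A y * indicator {0..} y \<partial>lborel) =
      (\<integral>\<^sup>+x. ennreal (indicator {0..} x * \<phi>' x) * indicator A (\<phi> x) \<partial>lborel)"
    unfolding eq by (rule LIMSEQ_unique)
  moreover have "emeasure (distr \<mu> borel \<phi>) A = (\<integral>\<^sup>+x. indicator A (\<phi> x) \<partial>\<mu>)"
  proof -
    have "emeasure (distr \<mu> borel \<phi>) A = (\<integral>\<^sup>+x. indicator A x \<partial>distr \<mu> borel \<phi>)" by simp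
    also have "\<dots> = (\<integral>\<^sup>+x. indicator A (\<phi> x) \<partial>\<mu>)" by (rule nn_integral_distr) auto
    finally show ?thesis .
  qed
  moreover have "\<dots> = (\<integral>\<^sup>+x. ennreal (indicator {0..} x * \<phi>' x) * indicator A (\<phi> x) \<partial>lborel)"
    unfolding \<mu>_def by (subst nn_integral_density) auto
  moreover have "emeasure (density lborel (indicator {0..})) A = (\<integral>\<^sup>+y. indicator A y * indicator {0..} y \<partial>lborel)"
    by (subst emeasure_density) (auto simp: mult.commute)
  ultimately show "emeasure (distr \<mu> borel \<phi>) A = emeasure (density lborel (indicator {0..})) A" by simp
qed simp

lemma
  fixes f :: "real \<Rightarrow> 'a :: {banach, second_countable_topology}"
  assumes [measurable]: "f \<in> borel_measurable borel"
  shows integrable_mu_comp: "integrable \<mu> (\<lambda>x. f (\<phi> x)) \<longleftrightarrow> integrable lborel (\<lambda>y. indicator {0..} y *\<^sub>R f y)"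
    and integral_mu_comp: "(\<integral>x. f (\<phi> x) \<partial>\<mu>) = (\<integral>y. indicator {0..} y *\<^sub>R f y \<partial>lborel)"
proof -
  have d: "density lborel (indicator {0..}) = density lborel (\<lambda>y. ennreal (indicator {0..} y))"
    by (rule arg_cong[where f = "density lborel"]) (auto simp: fun_eq_iff indicator_def)
  have "integrable \<mu> (\<lambda>x. f (\<phi> x)) \<longleftrightarrow> integrable (distr \<mu> borel \<phi>) f"
    by (rule integrable_distr_eq[symmetric]) auto
  also have "\<dots> \<longleftrightarrow> integrable lborel (\<lambda>y. indicator {0..} y *\<^sub>R f y)"
    unfolding distr_mu d by (rule integrable_density) auto
  finally show "integrable \<mu> (\<lambda>x. f (\<phi> x)) \<longleftrightarrow> integrable lborel (\<lambda>y. indicator {0..} y *\<^sub>R f y)" .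
  have "(\<integral>x. f (\<phi> x) \<partial>\<mu>) = integral\<^sup>L (distr \<mu> borel \<phi>) f"
    by (rule integral_distr[symmetric]) auto
  also have "\<dots> = (\<integral>y. indicator {0..} y *\<^sub>R f y \<partial>lborel)"
    unfolding distr_mu d by (rule integral_density) auto
  finally show "(\<integral>x. f (\<phi> x) \<partial>\<mu>) = (\<integral>y. indicator {0..} y *\<^sub>R f y \<partial>lborel)" .
qed

lemma
  assumes "\<delta> > 0"
  shows integrable_exp_mu: "integrable \<mu> (\<lambda>x. exp (- \<delta> * \<phi> x))"
    and integral_exp_mu: "(\<integral>x. exp (- \<delta> * \<phi> x) \<partial>\<mu>) = 1 / \<delta>"
proof -
  have hi: "((\<lambda>y. exp (- \<delta> * y)) has_integral exp (- \<delta> * 0) / \<delta>) {0..}"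
    by (rule has_integral_exp_minus_to_infinity) fact
  have "set_integrable lebesgue {0..} (\<lambda>y. exp (- \<delta> * y))"
    using hi by (intro nonnegative_absolutely_integrable_1) auto
  hence si: "set_integrable lborel {0..} (\<lambda>y. exp (- \<delta> * y))"
    unfolding set_integrable_def by (subst (asm) integrable_completion) auto
  show "integrable \<mu> (\<lambda>x. exp (- \<delta> * \<phi> x))"
    using si by (subst integrable_mu_comp) (auto simp: set_integrable_def)
  have "(\<integral>x. exp (- \<delta> * \<phi> x) \<partial>\<mu>) = (LINT y:{0..}|lborel. exp (- \<delta> * y))"
    by (subst integral_mu_comp) (auto simp: set_lebesgue_integral_def)
  also have "\<dots> = 1 / \<delta>"
    using set_borel_integral_eq_integral(2)[OF si] hi by (simp add: integral_unique)
  finally show "(\<integral>x. exp (- \<delta> * \<phi> x) \<partial>\<mu>) = 1 / \<delta>" .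
qed

lemma integrable_cexp_mu:
  assumes "Re w > 0"
  shows "integrable \<mu> (\<lambda>x. exp (- w * of_real (\<phi> x)))"
  by (rule Bochner_Integration.integrable_bound[OF integrable_exp_mu[OF assms]]) auto

lemma integrable_mu_bounded_mult:
  fixes f g :: "real \<Rightarrow> complex"
  assumes f: "integrable \<mu> f" and [measurable]: "g \<in> borel_measurable borel"
    and "\<And>x. norm (g x) \<le> B"
  shows "integrable \<mu> (\<lambda>x. f x * g x)"
proof (rule Bochner_Integration.integrable_bound)
  show "integrable \<mu> (\<lambda>x. B *\<^sub>R f x)" using f by simp
  have [measurable]: "f \<in> borel_measurable \<mu>" using f by simp
  show "(\<lambda>x. f x * g x) \<in> borel_measurable \<mu>" by measurable
  show "AE x in \<mu>. norm (f x * g x) \<le> norm (B *\<^sub>R f x)"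
  proof (rule AE_I2)
    fix x
    have "B \<ge> 0" using assms(3) norm_ge_zero order_trans by blast
    thus "norm (f x * g x) \<le> norm (B *\<^sub>R f x)"
      using assms(3)[of x] by (simp add: norm_mult mult.commute[of B] mult_left_mono)
  qed
qed

text \<open>The class in which every truncated transform is a Lebesgue integral while only the limit
  of the truncations may exist. The sets \<open>{..T}\<close> need no lower end, since \<mu> is
  concentrated on \<open>{0..}\<close>.\<close>

definition locally_mu_integrable :: "(real \<Rightarrow> complex) \<Rightarrow> bool" where
  "locally_mu_integrable f \<longleftrightarrow>
     f \<in> borel_measurable borel \<and> (\<forall>T. integrable \<mu> (\<lambda>x. indicator {..T} x *\<^sub>R f x))"

lemma
  assumes f: "locally_mu_integrable f"
  shows integrable_on_Icc: "(\<lambda>x. of_real (\<phi>' x) * f x) integrable_on {0..T}"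
    and integral_mu_Icc: "(\<integral>x. indicator {..T} x *\<^sub>R f x \<partial>\<mu>) = integral {0..T} (\<lambda>x. of_real (\<phi>' x) * f x)"
proof -
  have [measurable]: "f \<in> borel_measurable borel"
    and i: "integrable \<mu> (\<lambda>x. indicator {..T} x *\<^sub>R f x)"
    using f by (auto simp: locally_mu_integrable_def)
  have eq: "(indicator {0..} x * \<phi>' x) *\<^sub>R (indicator {..T} x *\<^sub>R f x) =
      indicator {0..T} x *\<^sub>R (of_real (\<phi>' x) * f x)" for x
    by (auto simp: indicator_def scaleR_conv_of_real)
  have "(\<lambda>x. indicator {..T} x *\<^sub>R f x) \<in> borel_measurable borel" by measurable
  from i[unfolded integrable_mu_iff[OF this] eq]
  have si: "set_integrable lborel {0..T} (\<lambda>x. of_real (\<phi>' x) * f x)"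
    by (simp only: set_integrable_def)
  show "(\<lambda>x. of_real (\<phi>' x) * f x) integrable_on {0..T}"
    using set_borel_integral_eq_integral(1)[OF si] .
  show "(\<integral>x. indicator {..T} x *\<^sub>R f x \<partial>\<mu>) = integral {0..T} (\<lambda>x. of_real (\<phi>' x) * f x)"
    unfolding set_borel_integral_eq_integral(2)[OF si, symmetric]
    by (subst integral_mu_eq, measurable, simp only: eq set_lebesgue_integral_def)
qed

lemma locally_mu_integrable_mult:
  assumes f: "locally_mu_integrable f" and g: "continuous_on UNIV g"
  shows "locally_mu_integrable (\<lambda>x. g x * f x)"
  unfolding locally_mu_integrable_def
proof (intro conjI allI)
  have [measurable]: "f \<in> borel_measurable borel"
    and i: "\<And>T. integrable \<mu> (\<lambda>x. indicator {..T} x *\<^sub>R f x)"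
    using f by (auto simp: locally_mu_integrable_def)
  have [measurable]: "g \<in> borel_measurable borel" using g by (rule borel_measurable_continuous_onI)
  show "(\<lambda>x. g x * f x) \<in> borel_measurable borel" by measurable
  fix T
  have "bounded (g ` {0..T})"
    by (intro compact_imp_bounded compact_continuous_image continuous_on_subset[OF g]) auto
  then obtain B where B: "B > 0" "\<And>x. x \<in> {0..T} \<Longrightarrow> norm (g x) \<le> B"
    unfolding bounded_pos by auto
  have "integrable \<mu> (\<lambda>x. (indicator {..T} x *\<^sub>R f x) * (indicator {0..T} x *\<^sub>R g x))"
    by (rule integrable_mu_bounded_mult[OF i, of _ B]) (use B in \<open>auto simp: indicator_def\<close>)
  also have "?this \<longleftrightarrow> integrable \<mu> (\<lambda>x. indicator {..T} x *\<^sub>R (g x * f x))"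
    by (subst (1 2) integrable_mu_iff) (auto intro!: Bochner_Integration.integrable_cong simp: indicator_def)
  finally show "integrable \<mu> (\<lambda>x. indicator {..T} x *\<^sub>R (g x * f x))" .
qed

lemma locally_mu_integrable_cexp:
  "locally_mu_integrable f \<Longrightarrow> locally_mu_integrable (\<lambda>x. exp (- s * of_real (\<phi> x)) * f x)"
  by (erule locally_mu_integrable_mult) (intro continuous_intros cont)

text \<open>Conditional convergence in a form accessible to measure theory: Henstock-Kurzweil
  convergence becomes a limit of Lebesgue integrals.\<close>

lemma has_gen_laplace_iff:
  assumes f: "locally_mu_integrable f"
  shows "has_gen_laplace \<phi> \<phi>' f s L \<longleftrightarrow>
    ((\<lambda>T. \<integral>x. indicator {..T} x *\<^sub>R (exp (- s * of_real (\<phi> x)) * f x) \<partial>\<mu>) \<longlongrightarrow> L) at_top"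
proof -
  note l = locally_mu_integrable_cexp[OF f, of s]
  have "has_gen_laplace \<phi> \<phi>' f s L \<longleftrightarrow>
      ((\<lambda>x. of_real (\<phi>' x) * (exp (- s * of_real (\<phi> x)) * f x)) has_integral L) {0..}"
    unfolding has_gen_laplace_def by (simp add: mult_ac)
  also have "\<dots> \<longleftrightarrow> ((\<lambda>T. integral {0..T} (\<lambda>x. of_real (\<phi>' x) * (exp (- s * of_real (\<phi> x)) * f x))) \<longlongrightarrow> L) at_top"
    by (rule has_integral_atLeast_iff_tendsto) (rule integrable_on_Icc[OF l])
  finally show ?thesis unfolding integral_mu_Icc[OF l] .
qed

lemma has_gen_laplace_integrable:
  assumes f: "f \<in> borel_measurable borel" "integrable \<mu> (\<lambda>x. exp (- s * of_real (\<phi> x)) * f x)"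
  shows "locally_mu_integrable f"
    and "has_gen_laplace \<phi> \<phi>' f s (\<integral>x. exp (- s * of_real (\<phi> x)) * f x \<partial>\<mu>)"
proof -
  note [measurable] = f(1)
  let ?g = "\<lambda>x. exp (- s * of_real (\<phi> x)) * f x"
  have "locally_mu_integrable ?g"
    unfolding locally_mu_integrable_def using f(2) by (auto intro!: integrable_mult_indicator)
  \<comment> \<open>Multiplication by the inverse exponential, which is bounded on compact
    intervals, recovers \<open>f\<close> from its weighted form.\<close>
  from locally_mu_integrable_cexp[OF this, of "- s"] show l: "locally_mu_integrable f"
    by (simp add: mult.assoc[symmetric] flip: exp_add)
  show "has_gen_laplace \<phi> \<phi>' f s (\<integral>x. ?g x \<partial>\<mu>)"
    unfolding has_gen_laplace_iff[OF l]
  proof (rule integral_dominated_convergence_at_top)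
    show "integrable \<mu> (\<lambda>x. norm (?g x))" using f(2) by simp
    show "AE x in \<mu>. ((\<lambda>T. indicator {..T} x *\<^sub>R ?g x) \<longlongrightarrow> ?g x) at_top"
    proof (rule AE_I2)
      fix x :: real
      have "\<forall>\<^sub>F T in at_top. T \<ge> x" by (rule eventually_ge_at_top)
      thus "((\<lambda>T. indicator {..T} x *\<^sub>R ?g x) \<longlongrightarrow> ?g x) at_top"
        by (intro tendsto_eventually, eventually_elim) auto
    qed
  qed (auto simp: indicator_def)
qed

end

section \<open>Integration by parts and the half-plane of convergence\<close>

lemma integral_norm_bound_integral_AE:
  fixes f :: "'a \<Rightarrow> 'b :: {banach, second_countable_topology}"
  assumes "integrable M f" "integrable M g" "AE x in M. norm (f x) \<le> g x"
  shows "norm (integral\<^sup>L M f) \<le> integral\<^sup>L M g"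
  using integral_norm_bound[of M f] integral_mono_AE[OF integrable_norm[OF assms(1)] assms(2,3)] by linarith

context c1_substitution
begin

lemma AE_mu_nonneg: "AE x in \<mu>. x \<ge> 0"
  unfolding \<mu>_def by (subst AE_density) (auto simp: indicator_def)

lemma has_integral_cexp:
  fixes w :: complex
  assumes "w \<noteq> 0" "a \<le> b"
  shows "((\<lambda>y. w * of_real (\<phi>' y) * exp (- w * of_real (\<phi> y))) has_integral
    exp (- w * of_real (\<phi> a)) - exp (- w * of_real (\<phi> b))) {a..b}"
proof -
  have "((\<lambda>y. - exp (- w * of_real (\<phi> y))) has_vector_derivative
      w * of_real (\<phi>' y) * exp (- w * of_real (\<phi> y))) (at y within {a..b})" for y
  proof -
    have "((\<lambda>y. complex_of_real (\<phi> y)) has_vector_derivative of_real (\<phi>' y)) (at y within {a..b})"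
      using deriv[of y] by (intro has_vector_derivative_of_real)
        (auto simp: has_real_derivative_iff_has_vector_derivative intro: has_vector_derivative_at_within)
    moreover have "((\<lambda>z. - exp (- w * z)) has_field_derivative w * exp (- w * of_real (\<phi> y)))
        (at (of_real (\<phi> y)) within (\<lambda>y. complex_of_real (\<phi> y)) ` {a..b})"
      by (auto intro!: derivative_eq_intros)
    ultimately show ?thesis
      using field_vector_diff_chain_within[of "\<lambda>y. complex_of_real (\<phi> y)"]
      by (fastforce simp: comp_def mult_ac)
  qed
  from fundamental_theorem_of_calculus[OF assms(2) this]
  show ?thesis by simp
qed

lemma tendsto_cexp_0:
  assumes "Re w > 0"
  shows "((\<lambda>T. exp (- w * of_real (\<phi> T))) \<longlongrightarrow> 0) at_top"
proof (rule tendsto_norm_zero_cancel)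
  have "((\<lambda>T. exp (- (Re w * \<phi> T))) \<longlongrightarrow> 0) at_top"
    by (rule filterlim_compose[OF exp_at_bot])
       (use filterlim_tendsto_pos_mult_at_top[OF tendsto_const assms unbounded] in
         \<open>simp add: filterlim_uminus_at_top\<close>)
  thus "((\<lambda>T. norm (exp (- w * complex_of_real (\<phi> T)))) \<longlongrightarrow> 0) at_top" by simp
qed

lemma locally_mu_integrable_1: "locally_mu_integrable (\<lambda>_. 1)"
  by (rule has_gen_laplace_integrable(1)[of _ 1]) (use integrable_cexp_mu[of 1] in auto)

lemma locally_mu_integrable_continuous:
  "continuous_on UNIV f \<Longrightarrow> locally_mu_integrable f"
  using locally_mu_integrable_mult[OF locally_mu_integrable_1, of f] by simp

lemma integral_cexp_mu:
  assumes "Re w > 0"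
  shows "(\<integral>x. exp (- w * of_real (\<phi> x)) \<partial>\<mu>) = 1 / w"
proof -
  have w: "w \<noteq> 0" using assms by auto
  note l1 = locally_mu_integrable_1
  note l = locally_mu_integrable_cexp[OF l1, of w]
  have "has_gen_laplace \<phi> \<phi>' (\<lambda>_. 1) w (\<integral>x. exp (- w * of_real (\<phi> x)) * 1 \<partial>\<mu>)"
    by (rule has_gen_laplace_integrable(2)) (use integrable_cexp_mu[OF assms] in auto)
  hence lim1: "((\<lambda>T. integral {0..T} (\<lambda>x. of_real (\<phi>' x) * (exp (- w * of_real (\<phi> x)) * 1))) \<longlongrightarrow>
      (\<integral>x. exp (- w * of_real (\<phi> x)) * 1 \<partial>\<mu>)) at_top"
    unfolding has_gen_laplace_iff[OF l1] integral_mu_Icc[OF l] .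
  have "((\<lambda>T. (1 - exp (- w * of_real (\<phi> T))) / w) \<longlongrightarrow> (1 - 0) / w) at_top"
    using w by (intro tendsto_intros tendsto_cexp_0 assms)
  moreover have "\<forall>\<^sub>F T in at_top. (1 - exp (- w * of_real (\<phi> T))) / w =
      integral {0..T} (\<lambda>x. of_real (\<phi>' x) * (exp (- w * of_real (\<phi> x)) * 1))"
    using eventually_ge_at_top[of 0]
  proof eventually_elim
    case (elim T)
    from integral_unique[OF has_integral_cexp[OF w elim]] show ?case
      using w by (simp add: mult.assoc field_simps)
  qed
  ultimately have "((\<lambda>T. integral {0..T} (\<lambda>x. of_real (\<phi>' x) * (exp (- w * of_real (\<phi> x)) * 1))) \<longlongrightarrow> (1 - 0) / w) at_top"
    by (rule Lim_transform_eventually)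
  from tendsto_unique[OF _ lim1 this] show ?thesis by simp
qed

definition mu_primitive :: "(real \<Rightarrow> complex) \<Rightarrow> real \<Rightarrow> complex" where
  "mu_primitive g T = (\<integral>x. indicator {..T} x *\<^sub>R g x \<partial>\<mu>)"

lemma mu_primitive_neg:
  assumes "locally_mu_integrable g" "T \<le> 0"
  shows "mu_primitive g T = 0"
proof (cases "T = 0")
  case True
  thus ?thesis unfolding mu_primitive_def using integral_mu_Icc[OF assms(1), of 0] by simp
next
  case False
  thus ?thesis unfolding mu_primitive_def using integral_mu_Icc[OF assms(1), of T] assms(2) by simp
qed

lemma continuous_on_mu_primitive:
  assumes g: "locally_mu_integrable g"
  shows "continuous_on S (mu_primitive g)"
proof -
  have "continuous_on {0..b} (mu_primitive g)" for b
    unfolding mu_primitive_def integral_mu_Icc[OF g]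
    by (intro indefinite_integral_continuous_1 integrable_on_Icc g)
  moreover have "continuous_on {..0} (mu_primitive g)"
    by (rule continuous_on_eq[OF continuous_on_const[of _ 0]]) (use mu_primitive_neg[OF g] in auto)
  ultimately have *: "continuous_on ({..0} \<union> {0..b}) (mu_primitive g)" for b
    by (intro continuous_on_closed_Un) auto
  have "isCont (mu_primitive g) x" for x
  proof -
    have "continuous_on {..<\<bar>x\<bar> + 1} (mu_primitive g)"
      by (rule continuous_on_subset[OF *[of "\<bar>x\<bar> + 1"]]) auto
    thus ?thesis by (rule continuous_on_interior) (auto simp: interior_open)
  qed
  thus ?thesis by (simp add: continuous_at_imp_continuous_on)
qed

text \<open>Continuity on a compact interval and the limit at infinity. Boundedness of the primitive
  replaces absolute integrability: after integration by parts it makes the remaining integral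
  absolutely convergent.\<close>

lemma mu_primitive_bounded:
  assumes g: "locally_mu_integrable g" and lim: "(mu_primitive g \<longlongrightarrow> L) at_top"
  obtains B where "B > 0" "\<And>T. norm (mu_primitive g T) \<le> B"
proof -
  have "\<forall>\<^sub>F T in at_top. norm (mu_primitive g T) < norm L + 1"
    using tendsto_norm[OF lim] by (rule order_tendstoD) simp
  then obtain X where X: "\<And>T. T \<ge> X \<Longrightarrow> norm (mu_primitive g T) < norm L + 1"
    by (auto simp: eventually_at_top_linorder)
  have "bounded (mu_primitive g ` {0..X})"
    by (intro compact_imp_bounded compact_continuous_image continuous_on_mu_primitive g) auto
  then obtain C where C: "C > 0" "\<And>T. T \<in> {0..X} \<Longrightarrow> norm (mu_primitive g T) \<le> C"
    unfolding bounded_pos by auto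
  show ?thesis
  proof (rule that[of "max C (norm L + 1)"])
    fix T
    consider "T \<le> 0" | "T \<in> {0..X}" | "T \<ge> X" by fastforce
    thus "norm (mu_primitive g T) \<le> max C (norm L + 1)"
    proof cases
      case 1
      thus ?thesis using mu_primitive_neg[OF g] C(1) by simp
    qed (use C(2)[of T] X[of T] in auto)
  qed (use C in auto)
qed

text \<open>Integration by parts; the boundary function need only be a primitive of an integrable
  function, so it is derived from Fubini's theorem on the triangle.\<close>

lemma mu_integral_by_parts:
  assumes g: "locally_mu_integrable g" and w: "w \<noteq> 0"
  shows "mu_primitive (\<lambda>x. exp (- w * of_real (\<phi> x)) * g x) T =
    exp (- w * of_real (\<phi> T)) * mu_primitive g T +
    w * mu_primitive (\<lambda>x. exp (- w * of_real (\<phi> x)) * mu_primitive g x) T"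
proof (cases "T \<ge> 0")
  case False
  moreover have "locally_mu_integrable (\<lambda>x. exp (- w * of_real (\<phi> x)) * mu_primitive g x)"
    by (intro locally_mu_integrable_continuous continuous_intros cont continuous_on_mu_primitive g)
  ultimately show ?thesis
    using mu_primitive_neg[of _ T] g locally_mu_integrable_cexp[OF g, of w] by simp
next
  case T: True
  let ?e = "\<lambda>x. exp (- w * of_real (\<phi> x)) :: complex"
  have [measurable]: "g \<in> borel_measurable borel" using g by (simp add: locally_mu_integrable_def)
  have [measurable]: "mu_primitive g \<in> borel_measurable borel"
    by (intro borel_measurable_continuous_onI continuous_on_mu_primitive g)
  have [measurable]: "?e \<in> borel_measurable borel"
    by (intro borel_measurable_continuous_onI continuous_intros cont)
  define gl where "gl x = (indicator {0..} x * \<phi>' x) *\<^sub>R (indicator {..T} x *\<^sub>R g x)" for x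
  define p where "p y = indicator {0..T} y *\<^sub>R (w * of_real (\<phi>' y) * ?e y)" for y
  have gl: "integrable lborel gl"
    using g unfolding locally_mu_integrable_def gl_def
    by (subst integrable_mu_iff[symmetric]) auto
  have p: "integrable lborel p"
    unfolding p_def set_integrable_def[symmetric]
    by (intro borel_integrable_atLeastAtMost' continuous_intros cont continuous_on_subset[OF cont_deriv]) auto
  define q where "q x = (\<integral>y. indicator {x..} y *\<^sub>R p y \<partial>lborel)" for x
  have tail: "q x = ?e x - ?e T" if "0 \<le> x" "x \<le> T" for x
  proof -
    have si: "set_integrable lborel {x..T} (\<lambda>y. w * of_real (\<phi>' y) * ?e y)"
      by (intro borel_integrable_atLeastAtMost' continuous_intros cont continuous_on_subset[OF cont_deriv]) auto
    have "q x = (LINT y:{x..T}|lborel. w * of_real (\<phi>' y) * ?e y)"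
      unfolding set_lebesgue_integral_def p_def q_def using that
      by (intro Bochner_Integration.integral_cong) (auto simp: indicator_def)
    also have "\<dots> = ?e x - ?e T"
      using set_borel_integral_eq_integral(2)[OF si] integral_unique[OF has_integral_cexp[OF w that(2)]] by simp
    finally show ?thesis .
  qed
  define r where "r y = (\<integral>x. indicator {..y} x *\<^sub>R gl x \<partial>lborel)" for y
  have head: "r y = mu_primitive g y" if "y \<le> T" for y
  proof -
    have "mu_primitive g y = (\<integral>x. (indicator {0..} x * \<phi>' x) *\<^sub>R (indicator {..y} x *\<^sub>R g x) \<partial>lborel)"
      unfolding mu_primitive_def by (subst integral_mu_eq) auto
    also have "\<dots> = r y"
      unfolding gl_def r_def using that by (intro Bochner_Integration.integral_cong) (auto simp: indicator_def)
    finally show ?thesis ..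
  qed
  have "mu_primitive (\<lambda>x. ?e x * g x) T =
      (\<integral>x. (indicator {0..} x * \<phi>' x) *\<^sub>R (indicator {..T} x *\<^sub>R (?e x * g x)) \<partial>lborel)"
    unfolding mu_primitive_def by (subst integral_mu_eq) auto
  \<comment> \<open>On \<open>{0..T}\<close> the exponential at \<open>x\<close> is its value at
    \<open>T\<close> plus the tail integral \<open>q x\<close> of \<open>p\<close>; the first
    summand is the boundary term, the second goes to Fubini.\<close>
  also have "\<dots> = (\<integral>x. ?e T * gl x + gl x * q x \<partial>lborel)"
    by (intro Bochner_Integration.integral_cong refl)
       (auto simp: gl_def indicator_def tail scaleR_conv_of_real algebra_simps)
  also have "\<dots> = ?e T * (\<integral>x. gl x \<partial>lborel) + (\<integral>x. gl x * q x \<partial>lborel)"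
  proof (subst Bochner_Integration.integral_add)
    have "integrable lborel (\<lambda>x. (indicator {0..} x * \<phi>' x) *\<^sub>R (indicator {..T} x *\<^sub>R (?e x * g x)) - ?e T * gl x)"
      using locally_mu_integrable_cexp[OF g, of w] gl unfolding locally_mu_integrable_def
      by (intro Bochner_Integration.integrable_diff integrable_mult_right)
         (subst integrable_mu_iff[symmetric], auto)
    also have "?this \<longleftrightarrow> integrable lborel (\<lambda>x. gl x * q x)"
      by (intro Bochner_Integration.integrable_cong refl)
         (auto simp: gl_def indicator_def tail scaleR_conv_of_real algebra_simps)
    finally show "integrable lborel (\<lambda>x. gl x * q x)" .
  qed (use gl in auto)
  also have "(\<integral>x. gl x \<partial>lborel) = mu_primitive g T"
    unfolding mu_primitive_def gl_def by (subst integral_mu_eq) auto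
  also have "(\<integral>x. gl x * q x \<partial>lborel) =
      (\<integral>y. p y * r y \<partial>lborel)"
    unfolding q_def r_def by (rule integral_triangle_swap[OF gl p])
  also have "\<dots> = (\<integral>y. w * ((indicator {0..} y * \<phi>' y) *\<^sub>R (indicator {..T} y *\<^sub>R (?e y * mu_primitive g y))) \<partial>lborel)"
    by (intro Bochner_Integration.integral_cong refl)
       (auto simp: p_def indicator_def head scaleR_conv_of_real)
  also have "\<dots> = w * mu_primitive (\<lambda>x. ?e x * mu_primitive g x) T"
    unfolding mu_primitive_def[of "\<lambda>x. ?e x * mu_primitive g x"]
    by (subst integral_mu_eq) (measurable, rule integral_mult_right_zero)
  finally show ?thesis .
qed

text \<open>The witness is (s - s0) H(s - s0), with \<open>H\<close> the transform of the bounded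
  primitive \<open>G\<close> of exp(- s0 \<phi>) f with respect to \<mu>. The boundary term of the
  integration by parts vanishes at infinity as the exponential decays and \<open>G\<close> is
  bounded. The limit at s0 exists along every ray into the half-plane, because |w| / Re w is
  constant on it.\<close>

lemma gen_laplace_halfplane:
  assumes f: "locally_mu_integrable f" and L: "has_gen_laplace \<phi> \<phi>' f s0 L"
  obtains F where "F holomorphic_on {s. Re s > Re s0}"
    and "\<And>s. Re s > Re s0 \<Longrightarrow> has_gen_laplace \<phi> \<phi>' f s (F s)"
    and "\<And>v. Re v > 0 \<Longrightarrow> ((\<lambda>t. F (s0 + of_real t * v)) \<longlongrightarrow> L) (at_right 0)"
proof -
  define g where "g x = exp (- s0 * of_real (\<phi> x)) * f x" for x
  have g: "locally_mu_integrable g"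
    unfolding g_def by (rule locally_mu_integrable_cexp[OF f])
  define G where "G = mu_primitive g"
  have lim: "(G \<longlongrightarrow> L) at_top"
    using L unfolding has_gen_laplace_iff[OF f] G_def mu_primitive_def g_def .
  obtain B where B: "B > 0" "\<And>T. norm (G T) \<le> B"
    using mu_primitive_bounded[OF g] lim unfolding G_def by blast
  have contG: "continuous_on S G" for S unfolding G_def by (rule continuous_on_mu_primitive[OF g])
  have [measurable]: "G \<in> borel_measurable borel"
    using contG by (rule borel_measurable_continuous_onI)
  define H where "H w = (\<integral>x. exp (- w * of_real (\<phi> x)) * G x \<partial>\<mu>)" for w
  define HT where "HT w = mu_primitive (\<lambda>x. exp (- w * of_real (\<phi> x)) * G x)" for w
  have intH: "integrable \<mu> (\<lambda>x. exp (- w * of_real (\<phi> x)) * G x)" if "Re w > 0" for w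
    by (rule integrable_mu_bounded_mult[OF integrable_cexp_mu[OF that] _ B(2)]) measurable
  have locH: "locally_mu_integrable (\<lambda>x. exp (- w * of_real (\<phi> x)) * G x)" for w
    by (intro locally_mu_integrable_continuous continuous_intros cont contG)
  have HT_Icc: "HT w T = integral {0..T} (\<lambda>x. of_real (\<phi>' x) * (exp (- w * of_real (\<phi> x)) * G x))" for w T
    unfolding HT_def mu_primitive_def by (rule integral_mu_Icc[OF locH])
  \<comment> \<open>Beyond \<open>T\<close> the decay exp(- \<delta> \<phi> x) is split in halves:
    one is estimated by its value at \<open>T\<close> and gives smallness uniform in
    \<open>w\<close>, the other integrates to 2 / \<delta>.\<close>
  have tail: "norm (HT w T - H w) \<le> 2 * B / \<delta> * exp (- (\<delta> / 2) * \<phi> T)"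
    if "\<delta> > 0" "Re w \<ge> \<delta>" "T \<ge> 0" for w T \<delta>
  proof -
    have int: "integrable \<mu> (\<lambda>x. indicator {..T} x *\<^sub>R (exp (- w * of_real (\<phi> x)) * G x))"
      using intH[of w] that by (intro integrable_mult_indicator) auto
    have diff: "HT w T - H w = (\<integral>x. indicator {..T} x *\<^sub>R (exp (- w * of_real (\<phi> x)) * G x) -
        exp (- w * of_real (\<phi> x)) * G x \<partial>\<mu>)"
      unfolding HT_def H_def mu_primitive_def using that
      by (intro Bochner_Integration.integral_diff[symmetric] int intH) auto
    have bound: "norm (HT w T - H w) \<le>
        (\<integral>x. B * exp (- (\<delta> / 2) * \<phi> T) * exp (- (\<delta> / 2) * \<phi> x) \<partial>\<mu>)"
      unfolding diff
    proof (rule Bochner_Integration.integral_norm_bound_integral)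
      show "integrable \<mu> (\<lambda>x. indicator {..T} x *\<^sub>R (exp (- w * of_real (\<phi> x)) * G x) -
        exp (- w * of_real (\<phi> x)) * G x)"
        using that by (intro Bochner_Integration.integrable_diff int intH) auto
      show "integrable \<mu> (\<lambda>x. B * exp (- (\<delta> / 2) * \<phi> T) * exp (- (\<delta> / 2) * \<phi> x))"
        using integrable_exp_mu[of "\<delta> / 2"] that by (intro integrable_mult_right) auto
      fix x
      show "norm (indicator {..T} x *\<^sub>R (exp (- w * of_real (\<phi> x)) * G x) - exp (- w * of_real (\<phi> x)) * G x)
          \<le> B * exp (- (\<delta> / 2) * \<phi> T) * exp (- (\<delta> / 2) * \<phi> x)"
      proof (cases "x \<le> T")
        case False
        hence x: "\<phi> T \<le> \<phi> x" "0 \<le> \<phi> x" using that by (auto intro: mono nonneg)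
        have "\<delta> * \<phi> x \<le> Re w * \<phi> x" using that x by (intro mult_right_mono) auto
        moreover have "\<delta> / 2 * \<phi> T \<le> \<delta> / 2 * \<phi> x" using that x by (intro mult_left_mono) auto
        ultimately have "exp (- (Re w * \<phi> x)) \<le> exp (- (\<delta> / 2) * \<phi> T + - (\<delta> / 2) * \<phi> x)"
          by (simp add: field_simps)
        hence "exp (- (Re w * \<phi> x)) * norm (G x) \<le> exp (- (\<delta> / 2) * \<phi> T + - (\<delta> / 2) * \<phi> x) * B"
          using B by (intro mult_mono) auto
        thus ?thesis using False unfolding exp_add by (simp add: norm_mult mult_ac)
      qed (use B in simp)
    qed
    have "(\<integral>x. B * exp (- (\<delta> / 2) * \<phi> T) * exp (- (\<delta> / 2) * \<phi> x) \<partial>\<mu>) =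
        2 * B / \<delta> * exp (- (\<delta> / 2) * \<phi> T)"
      using integral_exp_mu[of "\<delta> / 2"] that by simp
    with bound show ?thesis by (simp only:)
  qed
  have exp_lim: "((\<lambda>T. 2 * B / \<delta> * exp (- (\<delta> / 2) * \<phi> T)) \<longlongrightarrow> 0) at_top" if "\<delta> > 0" for \<delta>
    using tendsto_mult_right_zero[OF tendsto_norm_zero[OF tendsto_cexp_0[of "of_real (\<delta> / 2)"]], of "2 * B / \<delta>"] that
    by simp
  have ulim: "uniform_limit {w. Re w \<ge> \<delta>} (\<lambda>T w. HT w T) H at_top" if "\<delta> > 0" for \<delta>
  proof (rule uniform_limitI)
    fix e :: real assume "e > 0"
    with order_tendstoD(2)[OF exp_lim[OF that]]
    have "\<forall>\<^sub>F T in at_top. 2 * B / \<delta> * exp (- (\<delta> / 2) * \<phi> T) < e" by blast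
    with eventually_ge_at_top[of 0]
    show "\<forall>\<^sub>F T in at_top. \<forall>w\<in>{w. Re w \<ge> \<delta>}. dist (HT w T) (H w) < e"
    proof eventually_elim
      case (elim T)
      thus ?case using tail[OF that _ elim(1)] by (force simp: dist_norm)
    qed
  qed
  have H_lim: "((\<lambda>T. HT w T) \<longlongrightarrow> H w) at_top" if "Re w > 0" for w
    using tendsto_uniform_limitI[OF ulim[OF that], of w] by simp
  \<comment> \<open>Truncations are holomorphic by differentiation under a compact integral, and by
    \<open>ulim\<close> they converge uniformly on discs around \<open>w\<close> of radius Re w /
    2.\<close>
  have H_holo: "H holomorphic_on {w. Re w > 0}"
  proof (rule holomorphic_uniform_sequence[where f = "\<lambda>n w. HT w (real n)"])
    show "open {w. Re w > 0}" by (rule open_halfspace_Re_gt)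
    fix n
    have "(\<lambda>w. integral (cbox 0 (real n)) (\<lambda>x. of_real (\<phi>' x) * (exp (- w * of_real (\<phi> x)) * G x)))
        holomorphic_on {w. Re w > 0}"
    proof (rule leibniz_rule_holomorphic)
      show "((\<lambda>w. of_real (\<phi>' x) * (exp (- w * of_real (\<phi> x)) * G x)) has_field_derivative
          of_real (\<phi>' x) * (- of_real (\<phi> x) * exp (- w * of_real (\<phi> x)) * G x)) (at w within {w. Re w > 0})" for w x
        by (auto intro!: derivative_eq_intros)
      show "(\<lambda>x. of_real (\<phi>' x) * (exp (- w * of_real (\<phi> x)) * G x)) integrable_on cbox 0 (real n)" for w
        using integrable_on_Icc[OF locH] by simp
      have c: "continuous_on S (\<lambda>z. \<phi> (snd z))" "continuous_on S (\<lambda>z. \<phi>' (snd z))" "continuous_on S (\<lambda>z. G (snd z))"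
        for S :: "(complex \<times> real) set"
        by (rule continuous_on_compose2[OF cont[of UNIV] continuous_on_snd[OF continuous_on_id] subset_UNIV]
            continuous_on_compose2[OF cont_deriv continuous_on_snd[OF continuous_on_id] subset_UNIV]
            continuous_on_compose2[OF contG[of UNIV] continuous_on_snd[OF continuous_on_id] subset_UNIV])+
      show "continuous_on ({w. Re w > 0} \<times> cbox 0 (real n))
          (\<lambda>(w, x). of_real (\<phi>' x) * (- of_real (\<phi> x) * exp (- w * of_real (\<phi> x)) * G x))"
        unfolding case_prod_unfold by (intro continuous_intros c)
      show "convex {w. Re w > 0}" by (rule convex_halfspace_Re_gt)
    qed
    thus "(\<lambda>w. HT w (real n)) holomorphic_on {w. Re w > 0}" unfolding HT_Icc by simp
  next
    fix w :: complex assume "w \<in> {w. Re w > 0}"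
    hence w: "Re w > 0" by simp
    have sub: "cball w (Re w / 2) \<subseteq> {z. Re z \<ge> Re w / 2}"
    proof safe
      fix z assume "z \<in> cball w (Re w / 2)"
      hence "norm (w - z) \<le> Re w / 2" by (simp add: dist_norm)
      with abs_Re_le_cmod[of "w - z"] show "Re z \<ge> Re w / 2" by (simp add: abs_le_iff)
    qed
    have "uniform_limit (cball w (Re w / 2)) (\<lambda>n w. HT w (real n)) H sequentially"
      by (rule filterlim_compose[OF uniform_limit_on_subset[OF ulim sub] filterlim_real_sequentially]) (use w in simp)
    thus "\<exists>d>0. cball w d \<subseteq> {w. Re w > 0} \<and> uniform_limit (cball w d) (\<lambda>n w. HT w (real n)) H sequentially"
      using w sub by (intro exI[of _ "Re w / 2"]) (auto simp: subset_eq)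
  qed
  have lap: "has_gen_laplace \<phi> \<phi>' f (s0 + w) (w * H w)" if w: "Re w > 0" for w
  proof -
    have e: "exp (- w * c) * (exp (- s0 * c) * z) = exp (- (s0 + w) * c) * z" for c z
      unfolding mult.assoc[symmetric] exp_add[symmetric] by (simp add: algebra_simps)
    have "((\<lambda>T. exp (- w * of_real (\<phi> T)) * G T + w * HT w T) \<longlongrightarrow> 0 * L + w * H w) at_top"
      by (intro tendsto_intros tendsto_cexp_0 w lim H_lim)
    also have "(\<lambda>T. exp (- w * of_real (\<phi> T)) * G T + w * HT w T) =
        (\<lambda>T. \<integral>x. indicator {..T} x *\<^sub>R (exp (- (s0 + w) * of_real (\<phi> x)) * f x) \<partial>\<mu>)"
    proof
      fix T
      have "exp (- w * of_real (\<phi> T)) * G T + w * HT w T = mu_primitive (\<lambda>x. exp (- w * of_real (\<phi> x)) * g x) T"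
        unfolding G_def HT_def using w by (subst mu_integral_by_parts[OF g]) auto
      thus "exp (- w * of_real (\<phi> T)) * G T + w * HT w T =
          (\<integral>x. indicator {..T} x *\<^sub>R (exp (- (s0 + w) * of_real (\<phi> x)) * f x) \<partial>\<mu>)"
        by (simp only: mu_primitive_def g_def e)
    qed
    finally show ?thesis unfolding has_gen_laplace_iff[OF f] by simp
  qed
  have stolz: "((\<lambda>t. (of_real t * v) * H (of_real t * v)) \<longlongrightarrow> L) (at_right 0)" if v: "Re v > 0" for v
  proof -
    have "((\<lambda>t. (of_real t * v) * H (of_real t * v) - L) \<longlongrightarrow> 0) (at_right 0)"
    proof (rule tendstoI)
      fix e :: real assume e: "e > 0"
      \<comment> \<open>With w = t v the part beyond \<open>X\<close> contributes |w| \<epsilon> /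
        Re w = \<epsilon> |v| / Re v = e / 2; the part up to \<open>X\<close> contributes at most t
        |v| \<open>C\<close>, which vanishes as t tends to 0.\<close>
      define \<epsilon> where "\<epsilon> = e * Re v / (2 * norm v)"
      have nv: "norm v > 0" using v by auto
      have \<epsilon>: "\<epsilon> > 0" using e v nv by (simp add: \<epsilon>_def)
      from tendstoD[OF lim \<epsilon>] obtain X where X: "\<And>T. T \<ge> X \<Longrightarrow> norm (G T - L) < \<epsilon>"
        unfolding eventually_at_top_linorder dist_norm by blast
      define C where "C = (\<integral>x. indicator {..X} x *\<^sub>R (B + norm L) \<partial>\<mu>)"
      have iC: "integrable \<mu> (\<lambda>x. indicator {..X} x *\<^sub>R (B + norm L))"
      proof -
        have "integrable \<mu> (\<lambda>x. indicator {..X} x *\<^sub>R (1::complex))"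
          using locally_mu_integrable_1 by (auto simp: locally_mu_integrable_def)
        from integrable_norm[OF this] show ?thesis by (intro integrable_scaleR_left) simp
      qed
      have "((\<lambda>t. t * norm v * C) \<longlongrightarrow> 0 * norm v * C) (at_right 0)"
        by (intro tendsto_intros)
      hence "\<forall>\<^sub>F t in at_right 0. t * norm v * C < e / 2"
        using e by (intro order_tendstoD) auto
      moreover have "\<forall>\<^sub>F t in at_right (0::real). t > 0" by (simp add: eventually_at_filter)
      ultimately show "\<forall>\<^sub>F t in at_right 0. dist ((of_real t * v) * H (of_real t * v) - L) 0 < e"
      proof eventually_elim
        case (elim t)
        let ?w = "of_real t * v"
        have w: "Re ?w > 0" using elim v by simp
        \<comment> \<open>The transform of \<open>G - L\<close>. As the constant 1 has transform 1 /
          w, multiplication by w gives exactly w H(w) - L.\<close>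
        define J where "J = (\<integral>x. exp (- ?w * of_real (\<phi> x)) * G x - L * exp (- ?w * of_real (\<phi> x)) \<partial>\<mu>)"
        have J: "J = H ?w - L * (\<integral>x. exp (- ?w * of_real (\<phi> x)) \<partial>\<mu>)"
          unfolding J_def H_def integral_mult_right_zero[symmetric]
          by (intro Bochner_Integration.integral_diff intH integrable_cexp_mu integrable_mult_right w)
        have "?w * (L * (1 / ?w)) = L" using w by auto
        hence wJ: "?w * H ?w - L = ?w * J"
          by (simp only: J integral_cexp_mu[OF w] right_diff_distrib)
        have bound: "norm J \<le> (\<integral>x. indicator {..X} x *\<^sub>R (B + norm L) + \<epsilon> * exp (- Re ?w * \<phi> x) \<partial>\<mu>)"
          unfolding J_def
        proof (rule integral_norm_bound_integral_AE)
          show "integrable \<mu> (\<lambda>x. exp (- ?w * of_real (\<phi> x)) * G x - L * exp (- ?w * of_real (\<phi> x)))"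
            by (intro Bochner_Integration.integrable_diff intH integrable_cexp_mu integrable_mult_right w)
          show "integrable \<mu> (\<lambda>x. indicator {..X} x *\<^sub>R (B + norm L) + \<epsilon> * exp (- Re ?w * \<phi> x))"
            by (intro Bochner_Integration.integrable_add iC integrable_exp_mu integrable_mult_right w)
          show "AE x in \<mu>. norm (exp (- ?w * of_real (\<phi> x)) * G x - L * exp (- ?w * of_real (\<phi> x))) \<le>
              indicator {..X} x *\<^sub>R (B + norm L) + \<epsilon> * exp (- Re ?w * \<phi> x)"
            using AE_mu_nonneg
          proof eventually_elim
            case (elim x)
            have "norm (exp (- ?w * of_real (\<phi> x)) * G x - L * exp (- ?w * of_real (\<phi> x))) =
                norm (exp (- ?w * of_real (\<phi> x)) * (G x - L))"
              by (simp add: algebra_simps)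
            also have "\<dots> = exp (- Re ?w * \<phi> x) * norm (G x - L)" by (simp add: norm_mult)
            also have "\<dots> \<le> indicator {..X} x *\<^sub>R (B + norm L) + \<epsilon> * exp (- Re ?w * \<phi> x)"
            proof (cases "x \<le> X")
              case True
              have "norm (G x - L) \<le> B + norm L" using B(2)[of x] norm_triangle_ineq4[of "G x" L] by linarith
              moreover have "Re ?w * \<phi> x \<ge> 0" using w nonneg[OF elim] by (intro mult_nonneg_nonneg) auto
              ultimately have "exp (- Re ?w * \<phi> x) * norm (G x - L) \<le> 1 * (B + norm L)"
                using B(1) by (intro mult_mono) auto
              moreover have "\<epsilon> * exp (- Re ?w * \<phi> x) \<ge> 0" using \<epsilon> by simp
              ultimately show ?thesis using True by simp
            next
              case False
              with X[of x] show ?thesis by (simp add: mult.commute mult_left_mono)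
            qed
            finally show ?case .
          qed
        qed
        have "(\<integral>x. indicator {..X} x *\<^sub>R (B + norm L) + \<epsilon> * exp (- Re ?w * \<phi> x) \<partial>\<mu>) = C + \<epsilon> / Re ?w"
        proof -
          have "integrable \<mu> (\<lambda>x. \<epsilon> * exp (- Re ?w * \<phi> x))"
            by (intro integrable_mult_right integrable_exp_mu w)
          from Bochner_Integration.integral_add[OF iC this] show ?thesis
            by (simp only: C_def integral_mult_right_zero integral_exp_mu[OF w]) simp
        qed
        with bound have "norm (?w * H ?w - L) \<le> norm ?w * (C + \<epsilon> / Re ?w)"
          unfolding wJ norm_mult by (intro mult_left_mono) (simp_all only: mult_nonneg_nonneg norm_ge_zero)
        also have "\<dots> = t * norm v * C + e / 2"
          using elim v nv by (simp add: norm_mult distrib_left \<epsilon>_def field_simps)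
        finally show ?case using elim by simp
      qed
    qed
    thus ?thesis by (rule Lim_null[THEN iffD2])
  qed
  show ?thesis
  proof (rule that[of "\<lambda>s. (s - s0) * H (s - s0)"])
    have "(\<lambda>s. H (s - s0)) holomorphic_on {s. Re s > Re s0}"
      by (rule holomorphic_on_compose_gen[OF _ H_holo, unfolded comp_def]) (auto intro!: holomorphic_intros)
    thus "(\<lambda>s. (s - s0) * H (s - s0)) holomorphic_on {s. Re s > Re s0}"
      by (intro holomorphic_intros)
    show "has_gen_laplace \<phi> \<phi>' f s ((s - s0) * H (s - s0))" if "Re s > Re s0" for s
      using lap[of "s - s0"] that by simp
    show "((\<lambda>t. (s0 + of_real t * v - s0) * H (s0 + of_real t * v - s0)) \<longlongrightarrow> L) (at_right 0)" if "Re v > 0" for v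
      using stolz[OF that] by simp
  qed
qed

end

section \<open>Convolution\<close>

text \<open>On y \<le> b the weight is at least exp(- s b), so removing it costs a constant
  factor.\<close>

lemma integrable_restrict_from_laplace:
  fixes k :: "real \<Rightarrow> complex"
  assumes k: "integrable lborel (\<lambda>y. of_real (exp (- s * y)) * k y)" and k0: "\<And>y. y \<le> 0 \<Longrightarrow> k y = 0"
    and [measurable]: "k \<in> borel_measurable borel" and "s > 0"
  shows "integrable lborel (\<lambda>y. indicator {..b} y *\<^sub>R k y)"
proof (rule Bochner_Integration.integrable_bound)
  show "integrable lborel (\<lambda>y. exp (s * b) *\<^sub>R (of_real (exp (- s * y)) * k y))" using k by simp
  show "AE y in lborel. norm (indicator {..b} y *\<^sub>R k y) \<le> norm (exp (s * b) *\<^sub>R (of_real (exp (- s * y)) * k y))"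
  proof (rule AE_I2)
    fix y
    have "1 * norm (k y) \<le> exp (s * b + - s * y) * norm (k y)" if "y \<le> b"
      using that \<open>s > 0\<close> by (intro mult_right_mono) (auto simp: mult_left_mono)
    thus "norm (indicator {..b} y *\<^sub>R k y) \<le> norm (exp (s * b) *\<^sub>R (of_real (exp (- s * y)) * k y))"
      unfolding exp_add by (cases "y \<le> b") (auto simp: norm_mult mult.assoc)
  qed
qed measurable

lemma integrable_laplace_imp_measurable:
  fixes k :: "real \<Rightarrow> complex"
  assumes k: "integrable lborel (\<lambda>y. of_real (exp (- s * y)) * k y)"
  shows "k \<in> borel_measurable borel"
proof -
  have "(\<lambda>y. of_real (exp (- s * y)) * k y) \<in> borel_measurable borel"
    using borel_measurable_integrable[OF k] by simp
  hence "(\<lambda>y. of_real (exp (s * y)) * (of_real (exp (- s * y)) * k y)) \<in> borel_measurable borel"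
    by measurable
  also have "(\<lambda>y. of_real (exp (s * y)) * (of_real (exp (- s * y)) * k y)) = k"
    by (simp add: mult.assoc[symmetric] flip: of_real_mult exp_add)
  finally show ?thesis .
qed

context c1_substitution
begin

text \<open>Push forward along \<phi>, then translate by \<open>c\<close>. As \<open>k\<close>
  vanishes on the non-positive reals and c \<ge> 0, restricting to \<open>{0..}\<close> loses
  nothing. The value type is general so that the lemma serves both \<open>k\<close> and its
  real-valued norm.\<close>

lemma
  fixes k :: "real \<Rightarrow> 'a :: {banach, second_countable_topology}"
  assumes k: "integrable lborel (\<lambda>y. exp (- s * y) *\<^sub>R k y)" and k0: "\<And>y. y \<le> 0 \<Longrightarrow> k y = 0"
    and [measurable]: "k \<in> borel_measurable borel" and c: "c \<ge> 0"
  shows integrable_mu_shift: "integrable \<mu> (\<lambda>x. exp (- s * \<phi> x) *\<^sub>R k (\<phi> x - c))"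
    and integral_mu_shift: "(\<integral>x. exp (- s * \<phi> x) *\<^sub>R k (\<phi> x - c) \<partial>\<mu>) =
      exp (- s * c) *\<^sub>R (\<integral>y. exp (- s * y) *\<^sub>R k y \<partial>lborel)"
proof -
  have eq1: "indicator {0..} y *\<^sub>R (exp (- s * y) *\<^sub>R k (y - c)) = exp (- s * y) *\<^sub>R k (y - c)" for y
    using k0[of "y - c"] c by (cases "y \<le> c") (auto simp: indicator_def)
  have eq2: "exp (- s * (c + 1 * y)) *\<^sub>R k (c + 1 * y - c) = exp (- s * c) *\<^sub>R (exp (- s * y) *\<^sub>R k y)" for y
    by (simp add: algebra_simps mult_exp_exp)
  show "integrable \<mu> (\<lambda>x. exp (- s * \<phi> x) *\<^sub>R k (\<phi> x - c))"
  proof (subst integrable_mu_comp)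
    have "integrable lborel (\<lambda>y. exp (- s * (c + 1 * y)) *\<^sub>R k (c + 1 * y - c))"
      unfolding eq2 by (intro integrable_scaleR_right k)
    thus "integrable lborel (\<lambda>y. indicator {0..} y *\<^sub>R (exp (- s * y) *\<^sub>R k (y - c)))"
      unfolding eq1 using lborel_integrable_real_affine_iff[of 1 "\<lambda>y. exp (- s * y) *\<^sub>R k (y - c)" c] by simp
  qed measurable
  have "(\<integral>x. exp (- s * \<phi> x) *\<^sub>R k (\<phi> x - c) \<partial>\<mu>) =
      (\<integral>y. indicator {0..} y *\<^sub>R (exp (- s * y) *\<^sub>R k (y - c)) \<partial>lborel)"
    by (rule integral_mu_comp) measurable
  also have "\<dots> = \<bar>1\<bar> *\<^sub>R (\<integral>y. exp (- s * (c + 1 * y)) *\<^sub>R k (c + 1 * y - c) \<partial>lborel)"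
    unfolding eq1 by (rule lborel_integral_real_affine) simp
  also have "\<dots> = exp (- s * c) *\<^sub>R (\<integral>y. exp (- s * y) *\<^sub>R k y \<partial>lborel)"
    unfolding eq2 by (simp only: integral_scaleR_right abs_one scaleR_one)
  finally show "(\<integral>x. exp (- s * \<phi> x) *\<^sub>R k (\<phi> x - c) \<partial>\<mu>) =
      exp (- s * c) *\<^sub>R (\<integral>y. exp (- s * y) *\<^sub>R k y \<partial>lborel)" .
qed

text \<open>No upper limit of integration is written: for kernels vanishing on the non-positive
  reals, monotonicity of \<phi> removes all t > x.\<close>

definition mu_conv :: "(real \<Rightarrow> complex) \<Rightarrow> (real \<Rightarrow> complex) \<Rightarrow> real \<Rightarrow> complex" where
  "mu_conv k v x = (\<integral>t. k (\<phi> x - \<phi> t) * v t \<partial>\<mu>)"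

text \<open>Valid for every \<open>x\<close>, not just almost every: \<open>k\<close> is integrable
  up to \<phi> x despite a possible singularity at 0, reflection y -> \<phi> x - y preserves this,
  the push-forward transfers it to \<mu>, and \<open>v\<close> is bounded on
  \<open>{0..x}\<close>.\<close>

lemma mu_conv_eq_integral:
  assumes k: "integrable lborel (\<lambda>y. of_real (exp (- s * y)) * k y)" and k0: "\<And>y. y \<le> 0 \<Longrightarrow> k y = 0"
    and s: "s > 0"
    and [measurable]: "v \<in> borel_measurable borel" and v0: "\<And>t. t < 0 \<Longrightarrow> v t = 0"
    and vB: "\<And>t. t \<in> {0..x} \<Longrightarrow> norm (v t) \<le> B" and B: "B \<ge> 0"
  shows "mu_conv k v x = integral {0..x} (\<lambda>t. of_real (\<phi>' t) * (k (\<phi> x - \<phi> t) * v t))"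
proof -
  have [measurable]: "k \<in> borel_measurable borel" by (rule integrable_laplace_imp_measurable[OF k])
  have zero: "k (\<phi> x - \<phi> t) = 0" if "t > x" for t
    using k0 mono[of x t] that by simp
  have "integrable lborel (\<lambda>y. indicator {..\<phi> x} y *\<^sub>R k y)"
    by (rule integrable_restrict_from_laplace[OF k k0 _ s]) auto
  hence "integrable lborel (\<lambda>y. indicator {..\<phi> x} (\<phi> x + (- 1) * y) *\<^sub>R k (\<phi> x + (- 1) * y))"
    by (subst lborel_integrable_real_affine_iff) auto
  also have "(\<lambda>y. indicator {..\<phi> x} (\<phi> x + (- 1) * y) *\<^sub>R k (\<phi> x + (- 1) * y)) =
      (\<lambda>y. indicator {0..} y *\<^sub>R k (\<phi> x - y))"
    by (auto simp: indicator_def)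
  finally have "integrable \<mu> (\<lambda>t. k (\<phi> x - \<phi> t))"
    by (subst integrable_mu_comp[of "\<lambda>y. k (\<phi> x - y)"]) auto
  hence "integrable \<mu> (\<lambda>t. k (\<phi> x - \<phi> t) * (indicator {..x} t *\<^sub>R v t))"
  proof (rule integrable_mu_bounded_mult)
    show "norm (indicator {..x} t *\<^sub>R v t) \<le> B" for t
      using vB[of t] v0[of t] B by (cases "t < 0") (auto simp: indicator_def)
  qed measurable
  also have "(\<lambda>t. k (\<phi> x - \<phi> t) * (indicator {..x} t *\<^sub>R v t)) = (\<lambda>t. k (\<phi> x - \<phi> t) * v t)"
    using zero by (auto simp: indicator_def)
  finally have "locally_mu_integrable (\<lambda>t. k (\<phi> x - \<phi> t) * v t)"
    unfolding locally_mu_integrable_def by (auto intro!: integrable_mult_indicator)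
  note integral_mu_Icc[OF this, of x]
  moreover have "(\<lambda>t. indicator {..x} t *\<^sub>R (k (\<phi> x - \<phi> t) * v t)) = (\<lambda>t. k (\<phi> x - \<phi> t) * v t)"
    using zero by (auto simp: indicator_def)
  ultimately show ?thesis by (simp add: mu_conv_def)
qed

text \<open>The convolution theorem: integrating over \<open>x\<close> first, the shift by \<phi> t
  produces the factor exp(- s \<phi> t), which completes the transform of \<open>v\<close>. The same
  computation with norms supplies the integrability that Fubini requires.\<close>

lemma laplace_mu_conv:
  assumes k: "integrable lborel (\<lambda>y. of_real (exp (- s * y)) * k y)" and k0: "\<And>y. y \<le> 0 \<Longrightarrow> k y = 0"
    and [measurable]: "v \<in> borel_measurable borel" and v0: "\<And>t. t < 0 \<Longrightarrow> v t = 0"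
    and v: "integrable \<mu> (\<lambda>t. exp (- of_real s * of_real (\<phi> t)) * v t)"
  shows "locally_mu_integrable (mu_conv k v)"
    and "has_gen_laplace \<phi> \<phi>' (mu_conv k v) (of_real s)
      ((\<integral>y. of_real (exp (- s * y)) * k y \<partial>lborel) * (\<integral>t. exp (- of_real s * of_real (\<phi> t)) * v t \<partial>\<mu>))"
proof -
  have [measurable]: "k \<in> borel_measurable borel" by (rule integrable_laplace_imp_measurable[OF k])
  interpret sigma_finite_measure \<mu> by (rule sigma_finite_mu)
  interpret P: pair_sigma_finite \<mu> \<mu> ..
  define h where "h t x = (exp (- s * \<phi> x) *\<^sub>R k (\<phi> x - \<phi> t)) * v t" for t x
  have hm: "case_prod h \<in> borel_measurable (\<mu> \<Otimes>\<^sub>M \<mu>)" unfolding h_def by measurable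
  have k': "integrable lborel (\<lambda>y. exp (- s * y) *\<^sub>R k y)"
    using k by (simp add: scaleR_conv_of_real)
  have kn: "integrable lborel (\<lambda>y. exp (- s * y) *\<^sub>R norm (k y))"
    using integrable_norm[OF k] by (simp add: norm_mult)
  define K where "K = (\<integral>y. exp (- s * y) *\<^sub>R k y \<partial>lborel)"
  define K1 where "K1 = (\<integral>y. exp (- s * y) *\<^sub>R norm (k y) \<partial>lborel)"
  \<comment> \<open>For t < 0 the shift \<phi> t need not be non-negative, but there
    \<open>v\<close> is zero.\<close>
  have inner: "integrable \<mu> (h t)" for t
  proof (cases "t < 0")
    case False
    thus ?thesis unfolding h_def using integrable_mu_shift[OF k' k0, of "\<phi> t"] nonneg[of t]
      by (intro integrable_mult_left) auto
  qed (simp add: h_def[abs_def] v0)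
  have inner_eq: "(\<integral>x. h t x \<partial>\<mu>) = K * (exp (- of_real s * of_real (\<phi> t)) * v t)" for t
  proof (cases "t < 0")
    case False
    thus ?thesis unfolding h_def using integral_mu_shift[OF k' k0, of "\<phi> t"] nonneg[of t]
      by (simp add: K_def scaleR_conv_of_real exp_of_real[symmetric])
  qed (simp add: h_def v0)
  have inner_norm: "(\<integral>x. norm (h t x) \<partial>\<mu>) = K1 * norm (exp (- of_real s * of_real (\<phi> t)) * v t)" for t
  proof (cases "t < 0")
    case False
    have "(\<integral>x. norm (h t x) \<partial>\<mu>) = (\<integral>x. (exp (- s * \<phi> x) *\<^sub>R norm (k (\<phi> x - \<phi> t))) * norm (v t) \<partial>\<mu>)"
      by (intro Bochner_Integration.integral_cong refl) (simp add: h_def norm_mult)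
    also have "\<dots> = (exp (- s * \<phi> t) *\<^sub>R K1) * norm (v t)"
      using integral_mu_shift[OF kn, of "\<phi> t"] nonneg[of t] False k0 unfolding K1_def
      by (simp only: integral_mult_left_zero) simp
    finally show ?thesis by (simp add: norm_mult)
  qed (simp add: h_def v0)
  have hint: "integrable (\<mu> \<Otimes>\<^sub>M \<mu>) (case_prod h)"
  proof (rule P.Fubini_integrable[OF hm])
    show "integrable \<mu> (\<lambda>t. \<integral>x. norm (case (t, x) of (t, x) \<Rightarrow> h t x) \<partial>\<mu>)"
      using v by (simp only: prod.case inner_norm) (intro integrable_mult_right integrable_norm)
  qed (use inner in auto)
  have cm: "mu_conv k v \<in> borel_measurable borel"
  proof -
    have "(\<lambda>x. \<integral>t. k (\<phi> x - \<phi> t) * v t \<partial>\<mu>) \<in> borel_measurable borel"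
      by (rule borel_measurable_lebesgue_integral) measurable
    thus ?thesis by (simp add: mu_conv_def[abs_def])
  qed
  have hx: "(\<integral>t. h t x \<partial>\<mu>) = exp (- of_real s * of_real (\<phi> x)) * mu_conv k v x" for x
  proof -
    have "(\<integral>t. h t x \<partial>\<mu>) = (\<integral>t. exp (- of_real s * of_real (\<phi> x)) * (k (\<phi> x - \<phi> t) * v t) \<partial>\<mu>)"
      by (simp add: h_def scaleR_conv_of_real exp_of_real[symmetric] mult.assoc)
    thus ?thesis by (simp only: integral_mult_right_zero mu_conv_def)
  qed
  have ci: "integrable \<mu> (\<lambda>x. exp (- of_real s * of_real (\<phi> x)) * mu_conv k v x)"
    using P.integrable_snd[OF hint] unfolding hx .
  show "locally_mu_integrable (mu_conv k v)"
    by (rule has_gen_laplace_integrable(1)[OF cm ci])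
  have "(\<integral>x. exp (- of_real s * of_real (\<phi> x)) * mu_conv k v x \<partial>\<mu>) = (\<integral>t. (\<integral>x. h t x \<partial>\<mu>) \<partial>\<mu>)"
    using P.Fubini_integral[OF hint] unfolding hx .
  also have "\<dots> = K * (\<integral>t. exp (- of_real s * of_real (\<phi> t)) * v t \<partial>\<mu>)"
    unfolding inner_eq by (rule integral_mult_right_zero)
  finally have "(\<integral>x. exp (- of_real s * of_real (\<phi> x)) * mu_conv k v x \<partial>\<mu>) =
      K * (\<integral>t. exp (- of_real s * of_real (\<phi> t)) * v t \<partial>\<mu>)" .
  with has_gen_laplace_integrable(2)[OF cm ci]
  show "has_gen_laplace \<phi> \<phi>' (mu_conv k v) (of_real s)
      ((\<integral>y. of_real (exp (- s * y)) * k y \<partial>lborel) * (\<integral>t. exp (- of_real s * of_real (\<phi> t)) * v t \<partial>\<mu>))"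
    by (simp add: K_def scaleR_conv_of_real)
qed

end

section \<open>Boundedness and measurability of piecewise continuous functions\<close>

text \<open>Compactness through bisection: one-sided limits bound \<open>u\<close> on both sides of
  every point, and its value at the point is added separately. At the two end points the missing
  side meets \<open>{0..T}\<close> in the empty set.\<close>

lemma piecewise_continuous_bounded:
  assumes pc: "piecewise_continuous_on 0 T u" and T: "T > 0"
  obtains B where "B > 0" "\<And>x. x \<in> {0..T} \<Longrightarrow> \<bar>u x\<bar> \<le> B"
proof -
  define P where "P a b \<longleftrightarrow> (\<exists>B. \<forall>x\<in>{a..b} \<inter> {0..T}. \<bar>u x\<bar> \<le> B)" for a b
  have "P 0 T"
  proof (rule Bolzano)
    fix a b c :: real
    assume "P a b" "P b c"
    then obtain B C where "\<forall>x\<in>{a..b} \<inter> {0..T}. \<bar>u x\<bar> \<le> B" "\<forall>x\<in>{b..c} \<inter> {0..T}. \<bar>u x\<bar> \<le> C"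
      unfolding P_def by blast
    hence B: "\<And>x. x \<in> {a..b} \<inter> {0..T} \<Longrightarrow> \<bar>u x\<bar> \<le> B"
      and C: "\<And>x. x \<in> {b..c} \<inter> {0..T} \<Longrightarrow> \<bar>u x\<bar> \<le> C" by blast+
    have "\<bar>u x\<bar> \<le> max B C" if "x \<in> {a..c} \<inter> {0..T}" for x
    proof (cases "x \<le> b")
      case True
      with that have "x \<in> {a..b} \<inter> {0..T}" by simp
      from B[OF this] show ?thesis by (rule max.coboundedI1)
    next
      case False
      with that have "x \<in> {b..c} \<inter> {0..T}" by simp
      from C[OF this] show ?thesis by (rule max.coboundedI2)
    qed
    thus "P a c" unfolding P_def by blast
  next
    fix x assume x: "0 \<le> x" "x \<le> T"
    have "\<exists>l<x. \<exists>B. \<forall>y\<in>{l<..<x} \<inter> {0..T}. \<bar>u y\<bar> \<le> B"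
    proof (cases "x = 0")
      case False
      with pc x obtain l where l: "(u \<longlongrightarrow> l) (at_left x)"
        unfolding piecewise_continuous_on_def by force
      have "\<forall>\<^sub>F y in at_left x. \<bar>u y\<bar> < \<bar>l\<bar> + 1"
        using tendsto_rabs[OF l] by (rule order_tendstoD) simp
      then obtain b where b: "b < x" "\<And>y. b < y \<Longrightarrow> y < x \<Longrightarrow> \<bar>u y\<bar> < \<bar>l\<bar> + 1"
        unfolding eventually_at_left_field by blast
      hence "\<forall>y\<in>{b<..<x} \<inter> {0..T}. \<bar>u y\<bar> \<le> \<bar>l\<bar> + 1" by (simp add: less_imp_le)
      with b(1) show ?thesis by blast
    qed (auto intro!: exI[of _ "-1"])
    then obtain l B where l: "l < x" "\<And>y. y \<in> {l<..<x} \<inter> {0..T} \<Longrightarrow> \<bar>u y\<bar> \<le> B" by blast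
    have "\<exists>r>x. \<exists>B. \<forall>y\<in>{x<..<r} \<inter> {0..T}. \<bar>u y\<bar> \<le> B"
    proof (cases "x = T")
      case False
      with pc x obtain l where l: "(u \<longlongrightarrow> l) (at_right x)"
        unfolding piecewise_continuous_on_def by force
      have "\<forall>\<^sub>F y in at_right x. \<bar>u y\<bar> < \<bar>l\<bar> + 1"
        using tendsto_rabs[OF l] by (rule order_tendstoD) simp
      then obtain b where b: "b > x" "\<And>y. b > y \<Longrightarrow> y > x \<Longrightarrow> \<bar>u y\<bar> < \<bar>l\<bar> + 1"
        unfolding eventually_at_right_field by blast
      hence "\<forall>y\<in>{x<..<b} \<inter> {0..T}. \<bar>u y\<bar> \<le> \<bar>l\<bar> + 1" by (simp add: less_imp_le)
      with b(1) show ?thesis by blast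
    qed (auto intro!: exI[of _ "T + 1"])
    then obtain r C where r: "r > x" "\<And>y. y \<in> {x<..<r} \<inter> {0..T} \<Longrightarrow> \<bar>u y\<bar> \<le> C" by blast
    show "\<exists>d>0. \<forall>a b. a \<le> x \<and> x \<le> b \<and> b - a < d \<longrightarrow> P a b"
    proof (intro exI[of _ "min (x - l) (r - x)"] conjI allI impI)
      fix a b assume ab: "a \<le> x \<and> x \<le> b \<and> b - a < min (x - l) (r - x)"
      have "\<bar>u y\<bar> \<le> max (max B C) \<bar>u x\<bar>" if "y \<in> {a..b} \<inter> {0..T}" for y
      proof -
        have "a \<le> y" "y \<le> b" using that by simp_all
        hence y: "l < y" "y < r" using ab by linarith+
        show ?thesis
        proof (cases x y rule: linorder_cases)
          case less
          with y(2) that have "y \<in> {x<..<r} \<inter> {0..T}" by simp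
          from r(2)[OF this] show ?thesis by simp
        next
          case greater
          with y(1) that have "y \<in> {l<..<x} \<inter> {0..T}" by simp
          from l(2)[OF this] show ?thesis by simp
        qed simp
      qed
      thus "P a b" unfolding P_def by blast
    qed (use l r in auto)
  qed (use T in auto)
  then obtain B where "\<forall>x\<in>{0..T} \<inter> {0..T}. \<bar>u x\<bar> \<le> B" unfolding P_def by blast
  hence "\<bar>u x\<bar> \<le> max B 1" if "x \<in> {0..T}" for x
    using that by (auto simp: le_max_iff_disj)
  thus ?thesis by (intro that[of "max B 1"]) auto
qed

text \<open>The exceptional sets of all intervals \<open>{0..n+1}\<close>, together with 0 where the
  zero extension may jump, form a countable set; any other positive point is interior to one of
  these intervals.\<close>

lemma piecewise_continuous_imp_measurable:
  assumes pc: "\<And>T. T > 0 \<Longrightarrow> piecewise_continuous_on 0 T u"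
  shows "(\<lambda>x. if x \<ge> 0 then u x else 0) \<in> borel_measurable borel"
proof -
  have "\<exists>S. finite S \<and> continuous_on ({0..real (Suc n)} - S) u" for n
    using pc[of "real (Suc n)"] unfolding piecewise_continuous_on_def by simp
  then obtain S where S: "\<And>n. finite (S n)" "\<And>n. continuous_on ({0..real (Suc n)} - S n) u"
    by metis
  let ?v = "\<lambda>x. if x \<ge> 0 then u x else 0"
  show ?thesis
  proof (rule borel_measurable_continuous_countable_exceptions)
    show "countable (insert 0 (\<Union>n. S n))" using S(1) by (auto intro: countable_finite)
    have "isCont ?v x" if x: "x \<in> - insert 0 (\<Union>n. S n)" for x
    proof (cases "x < 0")
      case True
      have "continuous_on {..<0} ?v \<longleftrightarrow> continuous_on {..<0} (\<lambda>_::real. 0::real)"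
        by (rule continuous_on_cong) auto
      thus ?thesis using True by (simp add: continuous_on_eq_continuous_at)
    next
      case False
      with x have x0: "x > 0" by auto
      obtain n where "x < real n" using reals_Archimedean2[of x] by blast
      hence n: "x < real (Suc n)" by simp
      define U where "U = {0<..<real (Suc n)} - S n"
      have U: "open U" "x \<in> U" using x x0 n S(1) by (auto simp: U_def finite_imp_closed)
      have "continuous_on U u" by (rule continuous_on_subset[OF S(2)[of n]]) (auto simp: U_def)
      also have "?this \<longleftrightarrow> continuous_on U ?v" by (rule continuous_on_cong) (auto simp: U_def)
      finally show ?thesis using U by (simp add: continuous_on_eq_continuous_at)
    qed
    thus "continuous_on (- insert 0 (\<Union>n. S n)) ?v" by (intro continuous_at_imp_continuous_on) blast
  qed
qed

section \<open>Analytic continuation and the boundary\<close>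

lemma norm_of_real_powr_le_1:
  assumes "l \<ge> 1" "Re \<beta> > 0"
  shows "norm (of_real l powr (- \<beta>)) \<le> 1"
  using assms by (subst norm_powr_real_powr) (auto intro: powr_le_one_le simp: powr_mono[of "- Re \<beta>" 0 l, simplified])

text \<open>All \<beta> n + \<alpha> are positive combinations of \<alpha> and \<beta>, hence lie in
  one sector. There the passage from |Gamma| to Gamma of the real part costs a factor geometric in
  n, which the power of a large \<open>s\<close> absorbs.\<close>

lemma summable_Gamma_Re:
  fixes a :: "nat \<Rightarrow> complex"
  assumes \<alpha>: "Re \<alpha> > 0" and \<beta>: "Re \<beta> > 0" and conv: "conv_radius (gamma_coeff a \<alpha> \<beta>) > 0"
  obtains \<sigma> where "\<sigma> > 0"
    "\<And>s. s > \<sigma> \<Longrightarrow> summable (\<lambda>n. norm (a n) * Gamma (Re (\<beta> * of_nat n + \<alpha>)) * s powr (- Re (\<beta> * of_nat n + \<alpha>)))"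
proof -
  define e where "e n = \<beta> * of_nat n + \<alpha>" for n
  have Re_e: "Re (e n) = Re \<beta> * real n + Re \<alpha>" and Im_e: "Im (e n) = Im \<beta> * real n + Im \<alpha>" for n
    by (simp_all add: e_def)
  have e: "Re (e n) > 0" for n using \<alpha> \<beta> unfolding Re_e by (simp add: add_nonneg_pos)
  \<comment> \<open>The larger of the two slopes |Im| / Re of \<alpha> and \<beta> bounds the slope
    of every \<beta> n + \<alpha>.\<close>
  define M where "M = max (\<bar>Im \<beta>\<bar> / Re \<beta>) (\<bar>Im \<alpha>\<bar> / Re \<alpha>)"
  have M: "\<bar>Im (e n)\<bar> \<le> M * Re (e n)" for n
  proof -
    have "\<bar>Im \<beta>\<bar> \<le> M * Re \<beta>" "\<bar>Im \<alpha>\<bar> \<le> M * Re \<alpha>"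
      using \<alpha> \<beta> by (simp_all add: M_def pos_divide_le_eq[symmetric])
    moreover from this(1) have "\<bar>Im \<beta>\<bar> * real n \<le> M * Re \<beta> * real n" by (intro mult_right_mono) auto
    moreover have "\<bar>Im (e n)\<bar> \<le> \<bar>Im \<beta>\<bar> * real n + \<bar>Im \<alpha>\<bar>"
      unfolding Im_e using abs_triangle_ineq[of "Im \<beta> * real n" "Im \<alpha>"] by (simp add: abs_mult)
    ultimately show ?thesis unfolding Re_e by (simp add: algebra_simps)
  qed
  define E where "E = exp (M\<^sup>2 / 2)"
  have E: "E > 0" by (simp add: E_def)
  obtain r where r: "r > 0" "ereal r < conv_radius (gamma_coeff a \<alpha> \<beta>)"
    using ereal_dense2[OF conv] by auto
  \<comment> \<open>The n-th term will be bounded by a constant times |\<open>gamma_coeff\<close> n|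
    q^n with q = s^(- Re \<beta>) E^(Re \<beta>), so \<open>s\<close> must be large enough to push q
    below \<open>r\<close>.\<close>
  have "((\<lambda>s. s powr (- Re \<beta>) * E powr Re \<beta>) \<longlongrightarrow> 0 * E powr Re \<beta>) at_top"
    using \<beta> by (intro tendsto_intros tendsto_neg_powr filterlim_ident) auto
  hence "\<forall>\<^sub>F s in at_top. s powr (- Re \<beta>) * E powr Re \<beta> < r" using r by (intro order_tendstoD) auto
  then obtain N where N: "\<And>s. s \<ge> N \<Longrightarrow> s powr (- Re \<beta>) * E powr Re \<beta> < r"
    unfolding eventually_at_top_linorder by blast
  show ?thesis
  proof (rule that[of "max N 1"])
    fix s assume s: "s > max N 1"
    define q where "q = s powr (- Re \<beta>) * E powr Re \<beta>"
    have q: "0 \<le> q" "q \<le> r" using N[of s] s by (auto simp: q_def)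
    define C where "C = E * E powr Re \<alpha> * s powr (- Re \<alpha>)"
    have sum: "summable (\<lambda>n. C * norm (gamma_coeff a \<alpha> \<beta> n * of_real r ^ n))"
      using r by (intro summable_mult abs_summable_in_conv_radius) auto
    show "summable (\<lambda>n. norm (a n) * Gamma (Re (\<beta> * of_nat n + \<alpha>)) * s powr (- Re (\<beta> * of_nat n + \<alpha>)))"
    proof (rule summable_comparison_test'[OF sum])
      fix n
      have "Gamma (Re (e n)) \<le> exp (M\<^sup>2 / 2 * (1 + Re (e n))) * norm (Gamma (e n))"
        by (rule Gamma_Re_le_norm_Gamma[OF e M])
      also have "exp (M\<^sup>2 / 2 * (1 + Re (e n))) = E * E powr (Re (e n))"
        by (simp add: E_def exp_powr_real algebra_simps flip: exp_add)
      finally have "norm (a n) * Gamma (Re (e n)) * s powr (- Re (e n)) \<le>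
          norm (a n) * (E * E powr (Re (e n)) * norm (Gamma (e n))) * s powr (- Re (e n))"
        by (intro mult_left_mono mult_right_mono) auto
      also have "\<dots> = C * norm (gamma_coeff a \<alpha> \<beta> n) * q ^ n"
      proof -
        have "E powr (Re (e n)) = (E powr Re \<beta>) ^ n * E powr Re \<alpha>"
          unfolding Re_e using E by (simp add: powr_add powr_powr[symmetric] powr_realpow)
        moreover have "s powr (- Re (e n)) = (s powr (- Re \<beta>)) ^ n * s powr (- Re \<alpha>)"
        proof -
          have "- Re (e n) = (- Re \<beta>) * real n + (- Re \<alpha>)" unfolding Re_e by simp
          thus ?thesis using s by (simp only: powr_add powr_powr[symmetric]) (simp add: powr_realpow)
        qed
        ultimately show ?thesis
          by (simp add: C_def q_def gamma_coeff_def e_def norm_mult power_mult_distrib mult_ac)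
      qed
      also have "\<dots> \<le> C * norm (gamma_coeff a \<alpha> \<beta> n) * r ^ n"
        using q E by (intro mult_left_mono power_mono) (auto simp: C_def)
      finally show "norm (norm (a n) * Gamma (Re (\<beta> * of_nat n + \<alpha>)) * s powr (- Re (\<beta> * of_nat n + \<alpha>)))
          \<le> C * norm (gamma_coeff a \<alpha> \<beta> n * of_real r ^ n)"
        using r Gamma_real_pos[OF e, of n] by (simp add: norm_mult norm_power e_def mult.assoc)
    qed
  qed auto
qed

text \<open>Not a half-plane in general: |s^(-\<beta>)| = |s|^(- Re \<beta>) exp(Im \<beta> arg s).
  The bound is extended real to admit an infinite radius of convergence.\<close>

definition laplace_region :: "complex \<Rightarrow> ereal \<Rightarrow> real \<Rightarrow> complex set" where
  "laplace_region \<beta> r x0 = {s. Re s > x0 \<and> ereal (norm (s powr (- \<beta>))) < r}"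

lemma laplace_region_scale:
  assumes \<beta>: "Re \<beta> > 0" and s: "s \<in> laplace_region \<beta> r x0" and l: "l \<ge> 1" and x0: "x0 \<ge> 0"
  shows "of_real l * s \<in> laplace_region \<beta> r x0"
proof -
  have "(of_real l * s) powr (- \<beta>) = of_real l powr (- \<beta>) * s powr (- \<beta>)"
    using l by (intro powr_times_real_left) auto
  hence "norm ((of_real l * s) powr (- \<beta>)) \<le> 1 * norm (s powr (- \<beta>))"
    by (simp only: norm_mult) (intro mult_right_mono norm_of_real_powr_le_1 l \<beta> norm_ge_zero)
  hence "ereal (norm ((of_real l * s) powr (- \<beta>))) < r"
    using s unfolding laplace_region_def by (auto intro!: order.strict_trans1[of _ "ereal (norm (s powr (- \<beta>)))" r])
  moreover have "1 * Re s \<le> l * Re s" using l s x0 by (intro mult_right_mono) (auto simp: laplace_region_def)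
  ultimately show ?thesis using s by (auto simp: laplace_region_def)
qed

lemma open_laplace_region:
  assumes "x0 \<ge> 0"
  shows "open (laplace_region \<beta> r x0)"
proof -
  have "open ({s. Re s > x0} \<inter> (\<lambda>s. norm (s powr (- \<beta>))) -` (ereal -` {..<r}))"
  proof (rule continuous_open_preimage)
    show "continuous_on {s. Re s > x0} (\<lambda>s. norm (s powr (- \<beta>)))"
      using assms by (auto intro!: continuous_intros simp: complex_nonpos_Reals_iff)
    show "open (ereal -` {..<r})"
      by (intro open_vimage continuous_on_ereal continuous_on_id) auto
  qed (rule open_halfspace_Re_gt)
  also have "{s. Re s > x0} \<inter> (\<lambda>s. norm (s powr (- \<beta>))) -` (ereal -` {..<r}) = laplace_region \<beta> r x0"
    by (auto simp: laplace_region_def)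
  finally show ?thesis .
qed

text \<open>The argument of \<open>s\<close> is at most pi in modulus, so the angular factor of
  |s^(-\<beta>)| is bounded, while |s|^(- Re \<beta>) tends to 0.\<close>

lemma halfplane_subset_laplace_region:
  assumes \<beta>: "Re \<beta> > 0" and r: "r > 0" and x0: "x0 \<ge> 0"
  obtains \<sigma> where "\<sigma> > x0" "{s. Re s > \<sigma>} \<subseteq> laplace_region \<beta> r x0"
proof -
  obtain r' where r': "r' > 0" "ereal r' < r" using ereal_dense2[OF r] by auto
  have "((\<lambda>x. x powr (- Re \<beta>) * exp (\<bar>Im \<beta>\<bar> * pi)) \<longlongrightarrow> 0 * exp (\<bar>Im \<beta>\<bar> * pi)) at_top"
    using \<beta> by (intro tendsto_intros tendsto_neg_powr filterlim_ident) auto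
  hence "\<forall>\<^sub>F x in at_top. x powr (- Re \<beta>) * exp (\<bar>Im \<beta>\<bar> * pi) < r'" using r' by (intro order_tendstoD) auto
  then obtain N where N: "\<And>x. x \<ge> N \<Longrightarrow> x powr (- Re \<beta>) * exp (\<bar>Im \<beta>\<bar> * pi) < r'"
    unfolding eventually_at_top_linorder by blast
  show ?thesis
  proof (rule that[of "max N (x0 + 1)"], safe)
    fix s assume s: "Re s > max N (x0 + 1)"
    hence s0: "s \<noteq> 0" "norm s > 0" using x0 by auto
    have "norm (s powr (- \<beta>)) = exp (- Re \<beta> * ln (norm s)) * exp (Im \<beta> * Im (Ln s))"
      using s0 by (simp add: powr_def flip: exp_add)
    also have "\<dots> \<le> (norm s) powr (- Re \<beta>) * exp (\<bar>Im \<beta>\<bar> * pi)"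
    proof (intro mult_mono)
      have "\<bar>Im (Ln s)\<bar> \<le> pi" using mpi_less_Im_Ln[OF s0(1)] Im_Ln_le_pi[OF s0(1)] by (simp add: abs_le_iff)
      hence "\<bar>Im \<beta> * Im (Ln s)\<bar> \<le> \<bar>Im \<beta>\<bar> * pi" unfolding abs_mult by (intro mult_left_mono) auto
      thus "exp (Im \<beta> * Im (Ln s)) \<le> exp (\<bar>Im \<beta>\<bar> * pi)" by (simp add: abs_le_iff)
    qed (use s0 in \<open>auto simp: powr_def\<close>)
    also have "\<dots> < r'"
      using s complex_Re_le_cmod[of s] by (intro N) simp
    finally have "ereal (norm (s powr (- \<beta>))) < ereal r'" by simp
    also note r'(2)
    finally show "s \<in> laplace_region \<beta> r x0" using s by (simp add: laplace_region_def)
  qed auto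
qed

text \<open>Every point is joined to a far half-plane by the ray from the origin through it.\<close>

lemma connected_laplace_region:
  assumes \<beta>: "Re \<beta> > 0" and r: "r > 0" and x0: "x0 \<ge> 0"
  shows "connected (laplace_region \<beta> r x0)"
proof -
  obtain \<sigma> where \<sigma>: "\<sigma> > x0" "{s. Re s > \<sigma>} \<subseteq> laplace_region \<beta> r x0"
    using halfplane_subset_laplace_region[OF assms] .
  define ray where "ray s = (\<lambda>l. of_real l * s) ` {1..}" for s :: complex
  have conn: "connected (ray s \<union> {s. Re s > \<sigma>})" if "Re s > 0" for s
  proof (rule connected_Un)
    show "connected (ray s)" unfolding ray_def
      by (intro connected_continuous_image continuous_intros) auto
    show "connected {s. Re s > \<sigma>}"
      by (intro convex_connected convex_halfspace_Re_gt)
    \<comment> \<open>This multiple of \<open>s\<close> lies on the ray and has real part at least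
      \<sigma> + Re s > \<sigma>.\<close>
    have "(max 1 (\<sigma> / Re s + 1)) * Re s \<ge> (\<sigma> / Re s + 1) * Re s"
      using that by (intro mult_right_mono) auto
    moreover have "(\<sigma> / Re s + 1) * Re s = \<sigma> + Re s" using that by (simp add: field_simps)
    ultimately have "of_real (max 1 (\<sigma> / Re s + 1)) * s \<in> ray s \<inter> {s. Re s > \<sigma>}"
      using that by (auto simp: ray_def)
    thus "ray s \<inter> {s. Re s > \<sigma>} \<noteq> {}" by blast
  qed
  have "laplace_region \<beta> r x0 = (\<Union>s\<in>laplace_region \<beta> r x0. ray s \<union> {s. Re s > \<sigma>})"
  proof
    show "laplace_region \<beta> r x0 \<subseteq> (\<Union>s\<in>laplace_region \<beta> r x0. ray s \<union> {s. Re s > \<sigma>})"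
      unfolding ray_def by (force intro: image_eqI[of _ _ 1])
    show "(\<Union>s\<in>laplace_region \<beta> r x0. ray s \<union> {s. Re s > \<sigma>}) \<subseteq> laplace_region \<beta> r x0"
      using \<sigma>(2) laplace_region_scale[OF \<beta> _ _ x0] by (auto simp: ray_def)
  qed
  also have "connected \<dots>"
  proof (rule connected_Union)
    fix S assume "S \<in> (\<lambda>s. ray s \<union> {s. Re s > \<sigma>}) ` laplace_region \<beta> r x0"
    thus "connected S" using conn x0 by (auto simp: laplace_region_def)
  next
    have "of_real (\<sigma> + 1) \<in> {s. Re s > \<sigma>}" by simp
    thus "\<Inter> ((\<lambda>s. ray s \<union> {s. Re s > \<sigma>}) ` laplace_region \<beta> r x0) \<noteq> {}" by fastforce
  qed
  finally show ?thesis .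
qed

lemma transformed_kernel_holomorphic:
  assumes x0: "x0 \<ge> 0"
  shows "(\<lambda>s. s powr (- \<alpha>) * transformed_kernel a \<alpha> \<beta> (s powr (- \<beta>))) holomorphic_on
    laplace_region \<beta> (conv_radius (gamma_coeff a \<alpha> \<beta>)) x0"
proof -
  let ?c = "gamma_coeff a \<alpha> \<beta>" and ?S = "laplace_region \<beta> (conv_radius (gamma_coeff a \<alpha> \<beta>)) x0"
  have S: "?S \<inter> \<real>\<^sub>\<le>\<^sub>0 = {}" using x0 by (auto simp: laplace_region_def complex_nonpos_Reals_iff)
  have pw: "(\<lambda>s. s powr w) holomorphic_on ?S" for w
    using S by (intro holomorphic_intros) auto
  have "(\<lambda>z. eval_fps (Abs_fps ?c) z) holomorphic_on eball 0 (fps_conv_radius (Abs_fps ?c))"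
    by (intro holomorphic_on_eval_fps) auto
  hence "transformed_kernel a \<alpha> \<beta> holomorphic_on eball 0 (conv_radius ?c)"
    by (simp add: eval_fps_def fps_conv_radius_def transformed_kernel_def[abs_def])
  hence "transformed_kernel a \<alpha> \<beta> \<circ> (\<lambda>s. s powr (- \<beta>)) holomorphic_on ?S"
    by (rule holomorphic_on_compose_gen[OF pw]) (auto simp: laplace_region_def in_eball_iff)
  thus ?thesis by (intro holomorphic_on_mult pw) (simp add: comp_def)
qed

text \<open>Abel's theorem with the powers of s0^(-\<beta>) absorbed into the coefficients: the ray
  enters only through q(t) = (1 + t)^(-\<beta>), which approaches 1 inside a Stolz angle by
  \<open>norm_one_minus_exp_le\<close>.\<close>

lemma transformed_kernel_ray_limit:
  fixes s0 :: complex
  assumes \<beta>: "Re \<beta> > 0" and sum: "summable (\<lambda>n. gamma_coeff a \<alpha> \<beta> n * (s0 powr (- \<beta>)) ^ n)"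
  shows "((\<lambda>t. transformed_kernel a \<alpha> \<beta> ((of_real (1 + t) * s0) powr (- \<beta>))) \<longlongrightarrow>
    transformed_kernel a \<alpha> \<beta> (s0 powr (- \<beta>))) (at_right 0)"
proof -
  define q where "q t = of_real (1 + t) powr (- \<beta>)" for t :: real
  have ev: "\<forall>\<^sub>F t in at_right (0::real). t > 0" by (simp add: eventually_at_filter)
  have q_exp: "q t = exp (- \<beta> * of_real (ln (1 + t)))" if "t > 0" for t
    using that Ln_of_real[of "1 + t"] by (auto simp: q_def powr_def simp del: of_real_add)
  have "((\<lambda>t. \<Sum>n. (gamma_coeff a \<alpha> \<beta> n * (s0 powr (- \<beta>)) ^ n) * q t ^ n) \<longlongrightarrow>
      (\<Sum>n. gamma_coeff a \<alpha> \<beta> n * (s0 powr (- \<beta>)) ^ n)) (at_right 0)"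
  proof (rule Abel_limit_Stolz[OF sum, where K = "norm \<beta> / Re \<beta>"])
    have "((\<lambda>t. exp (- \<beta> * of_real (ln (1 + t)))) \<longlongrightarrow> exp (- \<beta> * of_real (ln (1 + 0)))) (at_right 0)"
      by (intro tendsto_intros) auto
    moreover have "\<forall>\<^sub>F t in at_right 0. exp (- \<beta> * of_real (ln (1 + t))) = q t"
      using ev by eventually_elim (simp add: q_exp)
    ultimately show "(q \<longlongrightarrow> 1) (at_right 0)" using Lim_transform_eventually by force
    show "\<forall>\<^sub>F t in at_right 0. norm (q t) < 1 \<and> norm (1 - q t) \<le> norm \<beta> / Re \<beta> * (1 - norm (q t))"
      using ev
    proof eventually_elim
      case (elim t)
      have "norm (q t) = exp (- Re \<beta> * ln (1 + t))" using elim by (simp add: q_exp)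
      moreover have "Re \<beta> * ln (1 + t) > 0" using elim \<beta> by simp
      ultimately show ?case using norm_one_minus_exp_le[OF \<beta>, of "ln (1 + t)"] elim by (simp add: q_exp)
    qed
  qed
  moreover have "\<forall>\<^sub>F t in at_right 0. (\<Sum>n. (gamma_coeff a \<alpha> \<beta> n * (s0 powr (- \<beta>)) ^ n) * q t ^ n) =
      transformed_kernel a \<alpha> \<beta> ((of_real (1 + t) * s0) powr (- \<beta>))"
    using ev
  proof eventually_elim
    case (elim t)
    hence "(of_real (1 + t) * s0) powr (- \<beta>) = q t * s0 powr (- \<beta>)"
      unfolding q_def by (intro powr_times_real_left) auto
    thus ?case by (simp add: transformed_kernel_def power_mult_distrib mult_ac)
  qed
  ultimately show ?thesis unfolding transformed_kernel_def by (rule Lim_transform_eventually)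
qed

lemma has_gen_laplace_unique:
  "has_gen_laplace \<phi> \<phi>' f s L \<Longrightarrow> has_gen_laplace \<phi> \<phi>' f s L' \<Longrightarrow> L = L'"
  unfolding has_gen_laplace_def by (rule has_integral_unique)

lemma has_gen_laplace_cong:
  assumes "\<And>x. x \<ge> 0 \<Longrightarrow> \<phi> x = \<psi> x" "\<And>x. x \<ge> 0 \<Longrightarrow> \<phi>' x = \<psi>' x" "\<And>x. x \<ge> 0 \<Longrightarrow> f x = g x"
  shows "has_gen_laplace \<phi> \<phi>' f s L \<longleftrightarrow> has_gen_laplace \<psi> \<psi>' g s L"
  unfolding has_gen_laplace_def using assms by (intro has_integral_cong) auto

section \<open>Propagation of the formula from large real arguments\<close>

context c1_substitution
begin

text \<open>Serves twice: with a large real \<open>s0\<close>, to obtain a half-plane on which the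
  formula holds, and with an arbitrary point of convergence as \<open>s0\<close>, to obtain the
  formula at that point itself.\<close>

lemma gen_laplace_identity:
  assumes \<beta>: "Re \<beta> > 0" and conv: "conv_radius (gamma_coeff a \<alpha> \<beta>) > 0" and s0: "Re s0 \<ge> 0"
    and v: "locally_mu_integrable v" and I: "locally_mu_integrable I"
    and Lv: "has_gen_laplace \<phi> \<phi>' v s0 Lv" and LI: "has_gen_laplace \<phi> \<phi>' I s0 LI"
    and real: "\<And>s. s > \<sigma> \<Longrightarrow> \<exists>L. has_gen_laplace \<phi> \<phi>' v (of_real s) L \<and>
      has_gen_laplace \<phi> \<phi>' I (of_real s)
        (of_real s powr (- \<alpha>) * transformed_kernel a \<alpha> \<beta> (of_real s powr (- \<beta>)) * L)"
  obtains F where "\<And>s. Re s > Re s0 \<Longrightarrow> has_gen_laplace \<phi> \<phi>' v s (F s)"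
    and "\<And>s. s \<in> laplace_region \<beta> (conv_radius (gamma_coeff a \<alpha> \<beta>)) (Re s0) \<Longrightarrow>
      has_gen_laplace \<phi> \<phi>' I s (s powr (- \<alpha>) * transformed_kernel a \<alpha> \<beta> (s powr (- \<beta>)) * F s)"
    and "Re s0 > 0 \<Longrightarrow> summable (\<lambda>n. gamma_coeff a \<alpha> \<beta> n * (s0 powr (- \<beta>)) ^ n) \<Longrightarrow>
      LI = s0 powr (- \<alpha>) * transformed_kernel a \<alpha> \<beta> (s0 powr (- \<beta>)) * Lv"
proof -
  let ?r = "conv_radius (gamma_coeff a \<alpha> \<beta>)"
  define T where "T s = s powr (- \<alpha>) * transformed_kernel a \<alpha> \<beta> (s powr (- \<beta>))" for s
  define S where "S = laplace_region \<beta> ?r (Re s0)"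
  obtain F where F: "F holomorphic_on {s. Re s > Re s0}"
    "\<And>s. Re s > Re s0 \<Longrightarrow> has_gen_laplace \<phi> \<phi>' v s (F s)"
    "\<And>w. Re w > 0 \<Longrightarrow> ((\<lambda>t. F (s0 + of_real t * w)) \<longlongrightarrow> Lv) (at_right 0)"
    using gen_laplace_halfplane[OF v Lv] by blast
  obtain G where G: "G holomorphic_on {s. Re s > Re s0}"
    "\<And>s. Re s > Re s0 \<Longrightarrow> has_gen_laplace \<phi> \<phi>' I s (G s)"
    "\<And>w. Re w > 0 \<Longrightarrow> ((\<lambda>t. G (s0 + of_real t * w)) \<longlongrightarrow> LI) (at_right 0)"
    using gen_laplace_halfplane[OF I LI] by blast
  obtain \<tau> where \<tau>: "\<tau> > Re s0" "{s. Re s > \<tau>} \<subseteq> S"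
    using halfplane_subset_laplace_region[OF \<beta> conv s0] unfolding S_def .
  have S_sub: "S \<subseteq> {s. Re s > Re s0}" by (auto simp: S_def laplace_region_def)
  have eq: "G s = T s * F s" if s: "s \<in> S" for s
  proof -
    define m where "m = max \<sigma> \<tau>"
    \<comment> \<open>The segment (m, m + 2) accumulates at its midpoint m + 1; m \<ge> \<tau>
      places it in the region, m \<ge> \<sigma> makes \<open>real\<close> applicable on it.\<close>
    have "G s - T s * F s = 0"
    proof (rule analytic_continuation[where f = "\<lambda>s. G s - T s * F s" and S = S
          and U = "complex_of_real ` {m<..<m + 2}" and \<xi> = "of_real (m + 1)"])
      show "(\<lambda>s. G s - T s * F s) holomorphic_on S"
        unfolding T_def S_def using S_sub s0
        by (intro holomorphic_intros transformed_kernel_holomorphic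
            holomorphic_on_subset[OF F(1)] holomorphic_on_subset[OF G(1)]) (auto simp: S_def)
      show "open S" unfolding S_def by (rule open_laplace_region[OF s0])
      show "connected S" unfolding S_def by (rule connected_laplace_region[OF \<beta> conv s0])
      show "of_real ` {m<..<m + 2} \<subseteq> S" "complex_of_real (m + 1) \<in> S"
        using \<tau>(2) by (auto simp: m_def)
      show "complex_of_real (m + 1) islimpt complex_of_real ` {m<..<m + 2}"
      proof (rule islimpt_isCont_image)
        show "(m + 1) islimpt {m<..<m + 2}" by (simp add: islimpt_greaterThanLessThan1 interior_limit_point)
        show "\<forall>\<^sub>F y in at (m + 1). complex_of_real y \<noteq> complex_of_real (m + 1)"
          by (simp add: eventually_at_filter del: of_real_add)
      qed (intro continuous_intros)
      fix z assume "z \<in> complex_of_real ` {m<..<m + 2}"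
      then obtain x where x: "z = of_real x" "x > m" by auto
      with \<tau>(1) have Re: "Re z > Re s0" and "x > \<sigma>" by (auto simp: m_def)
      from real[OF this(2)] obtain L where L: "has_gen_laplace \<phi> \<phi>' v z L"
        "has_gen_laplace \<phi> \<phi>' I z (T z * L)" unfolding x T_def by blast
      show "G z - T z * F z = 0"
        using has_gen_laplace_unique[OF F(2)[OF Re] L(1)] has_gen_laplace_unique[OF G(2)[OF Re] L(2)] by simp
    qed (rule s)
    thus ?thesis by simp
  qed
  show ?thesis
  proof (rule that[of F])
    show "has_gen_laplace \<phi> \<phi>' I s (s powr (- \<alpha>) * transformed_kernel a \<alpha> \<beta> (s powr (- \<beta>)) * F s)"
      if "s \<in> laplace_region \<beta> ?r (Re s0)" for s
      using G(2)[of s] eq[of s] that S_sub by (auto simp: T_def S_def)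
    assume pos: "Re s0 > 0" and sum: "summable (\<lambda>n. gamma_coeff a \<alpha> \<beta> n * (s0 powr (- \<beta>)) ^ n)"
    define ray where "ray t = of_real (1 + t) * s0" for t :: real
    \<comment> \<open>The direction of approach is \<open>s0\<close> itself, admissible because its
      real part is positive; it turns the translated ray of the integrals into the dilated ray of
      the series.\<close>
    have ray_eq: "s0 + of_real t * s0 = ray t" for t by (simp add: ray_def algebra_simps)
    have ray_lim: "(ray \<longlongrightarrow> of_real (1 + 0) * s0) (at_right 0)" unfolding ray_def by (intro tendsto_intros)
    have ev: "\<forall>\<^sub>F t in at_right (0::real). t > 0" by (simp add: eventually_at_filter)
    \<comment> \<open>Summability at \<open>s0\<close> only gives |s0^(-\<beta>)| \<le> radius; the
      factor (1 + t)^(-\<beta>), of modulus below 1, makes the inequality strict.\<close>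
    have ray_S: "ray t \<in> S" if t: "t > 0" for t
    proof -
      have "s0 \<noteq> 0" using pos by auto
      have "ray t powr (- \<beta>) = of_real (1 + t) powr (- \<beta>) * s0 powr (- \<beta>)"
        unfolding ray_def using t by (intro powr_times_real_left) auto
      moreover have "norm (complex_of_real (1 + t) powr (- \<beta>)) < 1"
        using t \<beta> by (subst norm_powr_real_powr) (auto simp: powr_less_one)
      ultimately have "norm (ray t powr (- \<beta>)) < norm (s0 powr (- \<beta>))"
        using \<open>s0 \<noteq> 0\<close> by (simp add: norm_mult)
      also have "ereal (norm (s0 powr (- \<beta>))) \<le> ?r" by (rule conv_radius_geI[OF sum])
      finally have "ereal (norm (ray t powr (- \<beta>))) < ?r" by simp
      moreover have "Re (ray t) > Re s0" using t pos by (simp add: ray_def algebra_simps)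
      ultimately show ?thesis by (simp add: S_def laplace_region_def)
    qed
    have "((\<lambda>t. T (ray t) * F (ray t)) \<longlongrightarrow> T s0 * Lv) (at_right 0)"
    proof (intro tendsto_mult)
      show "((\<lambda>t. F (ray t)) \<longlongrightarrow> Lv) (at_right 0)" using F(3)[OF pos] unfolding ray_eq .
      have "((\<lambda>t. ray t powr (- \<alpha>)) \<longlongrightarrow> (of_real (1 + 0) * s0) powr (- \<alpha>)) (at_right 0)"
        by (intro tendsto_powr_complex ray_lim tendsto_const) (use pos in \<open>auto simp: complex_nonpos_Reals_iff\<close>)
      moreover have "((\<lambda>t. transformed_kernel a \<alpha> \<beta> (ray t powr (- \<beta>))) \<longlongrightarrow>
          transformed_kernel a \<alpha> \<beta> (s0 powr (- \<beta>))) (at_right 0)"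
        unfolding ray_def by (rule transformed_kernel_ray_limit[OF \<beta> sum])
      ultimately show "((\<lambda>t. T (ray t)) \<longlongrightarrow> T s0) (at_right 0)"
        unfolding T_def by (intro tendsto_mult) simp_all
    qed
    moreover have "((\<lambda>t. G (ray t)) \<longlongrightarrow> LI) (at_right 0)" using G(3)[OF pos] unfolding ray_eq .
    hence "((\<lambda>t. T (ray t) * F (ray t)) \<longlongrightarrow> LI) (at_right 0)"
      by (rule Lim_transform_eventually) (use ev in \<open>eventually_elim, simp add: eq ray_S\<close>)
    ultimately have "T s0 * Lv = LI" using tendsto_unique[OF trivial_limit_at_right_real] by blast
    thus "LI = s0 powr (- \<alpha>) * transformed_kernel a \<alpha> \<beta> (s0 powr (- \<beta>)) * Lv" by (simp add: T_def)
  qed (rule F(2))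
qed

lemma integrable_exp_order:
  fixes v :: "real \<Rightarrow> complex"
  assumes [measurable]: "v \<in> borel_measurable borel" and v0: "\<And>x. x < 0 \<Longrightarrow> v x = 0"
    and M: "\<And>x. x \<ge> 0 \<Longrightarrow> norm (v x) \<le> M * exp (c * \<phi> x)" and s: "s > c"
  shows "integrable \<mu> (\<lambda>x. exp (- of_real s * of_real (\<phi> x)) * v x)"
proof (rule Bochner_Integration.integrable_bound)
  show "integrable \<mu> (\<lambda>x. M * exp (- (s - c) * \<phi> x))"
    using s by (intro integrable_mult_right integrable_exp_mu) auto
  show "AE x in \<mu>. norm (exp (- of_real s * of_real (\<phi> x)) * v x) \<le> norm (M * exp (- (s - c) * \<phi> x))"
  proof (rule AE_I2)
    fix x
    show "norm (exp (- of_real s * of_real (\<phi> x)) * v x) \<le> norm (M * exp (- (s - c) * \<phi> x))"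
    proof (cases "x < 0")
      case False
      have "exp (- s * \<phi> x) * norm (v x) \<le> exp (- s * \<phi> x) * (M * exp (c * \<phi> x))"
        using M[of x] False by (intro mult_left_mono) auto
      also have "\<dots> = M * exp (- (s - c) * \<phi> x)"
        by (simp add: mult_exp_exp left_diff_distrib)
      finally show ?thesis by (simp add: norm_mult)
    qed (simp add: v0)
  qed
qed measurable

lemma laplace_series_conv:
  fixes v :: "real \<Rightarrow> complex"
  assumes \<alpha>: "Re \<alpha> > 0" and \<beta>: "Re \<beta> > 0" and A: "\<And>z. (\<lambda>n. a n * z ^ n) sums A z"
    and conv: "conv_radius (gamma_coeff a \<alpha> \<beta>) > 0"
    and v [measurable]: "v \<in> borel_measurable borel" and v0: "\<And>x. x < 0 \<Longrightarrow> v x = 0"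
    and M: "\<And>x. x \<ge> 0 \<Longrightarrow> norm (v x) \<le> M * exp (c * \<phi> x)"
  defines "I \<equiv> mu_conv (series_kernel \<alpha> \<beta> A) v"
  obtains \<sigma> where "\<And>x. x \<ge> 0 \<Longrightarrow> I x = integral {0..x}
      (\<lambda>t. of_real (\<phi>' t) * (series_kernel \<alpha> \<beta> A (\<phi> x - \<phi> t) * v t))"
    and "locally_mu_integrable v" "locally_mu_integrable I"
    and "\<And>s. s > \<sigma> \<Longrightarrow> \<exists>L. has_gen_laplace \<phi> \<phi>' v (of_real s) L \<and>
      has_gen_laplace \<phi> \<phi>' I (of_real s)
        (of_real s powr (- \<alpha>) * transformed_kernel a \<alpha> \<beta> (of_real s powr (- \<beta>)) * L)"
proof -
  let ?k = "series_kernel \<alpha> \<beta> A"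
  obtain \<sigma>0 where \<sigma>0: "\<sigma>0 > 0" "\<And>s. s > \<sigma>0 \<Longrightarrow>
      summable (\<lambda>n. norm (a n) * Gamma (Re (\<beta> * of_nat n + \<alpha>)) * s powr (- Re (\<beta> * of_nat n + \<alpha>)))"
    using summable_Gamma_Re[OF \<alpha> \<beta> conv] by blast
  \<comment> \<open>Beyond \<sigma>0 the kernel has an absolutely convergent transform, beyond
    \<open>c\<close> so does \<open>v\<close>.\<close>
  define \<sigma> where "\<sigma> = max \<sigma>0 c"
  have k0: "?k y = 0" if "y \<le> 0" for y using that by (simp add: series_kernel_def)
  have k: "integrable lborel (\<lambda>y. of_real (exp (- s * y)) * ?k y)" if "s > \<sigma>" for s
    using that \<sigma>0 by (intro integrable_laplace_series_kernel[OF \<alpha> \<beta> A]) (auto simp: \<sigma>_def)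
  have vint: "integrable \<mu> (\<lambda>x. exp (- of_real s * of_real (\<phi> x)) * v x)" if "s > \<sigma>" for s
    using that by (intro integrable_exp_order[OF v v0 M]) (auto simp: \<sigma>_def)
  show ?thesis
  proof (rule that[of \<sigma>])
    fix x :: real assume x: "x \<ge> 0"
    have M0: "M \<ge> 0" using order_trans[OF norm_ge_zero M[of 0]] by simp
    have "norm (v t) \<le> M * exp (\<bar>c\<bar> * \<phi> x)" if "t \<in> {0..x}" for t
    proof -
      have "c * \<phi> t \<le> \<bar>c\<bar> * \<phi> x"
        using that nonneg[of t] by (intro mult_mono mono) auto
      hence "M * exp (c * \<phi> t) \<le> M * exp (\<bar>c\<bar> * \<phi> x)" using M0 by (intro mult_left_mono) auto
      with M[of t] that show ?thesis by auto
    qed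
    thus "I x = integral {0..x} (\<lambda>t. of_real (\<phi>' t) * (?k (\<phi> x - \<phi> t) * v t))"
      unfolding I_def using \<sigma>0(1) M0
      by (intro mu_conv_eq_integral[OF k[of "\<sigma> + 1"] k0 _ v v0, where B = "M * exp (\<bar>c\<bar> * \<phi> x)"]) (auto simp: \<sigma>_def)
  next
    show "locally_mu_integrable v" "locally_mu_integrable I"
      using has_gen_laplace_integrable(1)[OF v vint[of "\<sigma> + 1"]]
        laplace_mu_conv(1)[OF k[of "\<sigma> + 1"] k0 v v0 vint[of "\<sigma> + 1"]]
      unfolding I_def by simp_all
  next
    fix s assume s: "s > \<sigma>"
    have "(\<integral>y. of_real (exp (- s * y)) * ?k y \<partial>lborel) =
        of_real s powr (- \<alpha>) * transformed_kernel a \<alpha> \<beta> (of_real s powr (- \<beta>))"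
      using s \<sigma>0 by (intro integral_laplace_series_kernel[OF \<alpha> \<beta> A]) (auto simp: \<sigma>_def)
    with has_gen_laplace_integrable(2)[OF v vint[OF s]] laplace_mu_conv(2)[OF k[OF s] k0 v v0 vint[OF s]]
    show "\<exists>L. has_gen_laplace \<phi> \<phi>' v (of_real s) L \<and> has_gen_laplace \<phi> \<phi>' I (of_real s)
        (of_real s powr (- \<alpha>) * transformed_kernel a \<alpha> \<beta> (of_real s powr (- \<beta>)) * L)"
      unfolding I_def by auto
  qed
qed

end

section \<open>Reduction of the hypotheses on the half-line, and conclusion\<close>

text \<open>On \<open>{0..X}\<close> the bound of the piecewise continuous function suffices, since
  exp(c \<phi> x) \<ge> 1 there.\<close>

lemma exponential_order_global_bound:
  assumes order: "phi_exponential_order \<phi> c u" and nonneg: "\<And>x. x \<ge> 0 \<Longrightarrow> \<phi> x \<ge> 0"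
    and pc: "\<And>T. T > 0 \<Longrightarrow> piecewise_continuous_on 0 T u"
  obtains M where "\<And>x. x \<ge> 0 \<Longrightarrow> \<bar>u x\<bar> \<le> M * exp (c * \<phi> x)"
proof -
  from order obtain M X where M: "M > 0" "X > 0" "\<And>x. x > X \<Longrightarrow> \<bar>u x\<bar> \<le> M * exp (c * \<phi> x)" and c: "c > 0"
    unfolding phi_exponential_order_def by blast
  obtain B where B: "B > 0" "\<And>x. x \<in> {0..X} \<Longrightarrow> \<bar>u x\<bar> \<le> B"
    using piecewise_continuous_bounded[OF pc[OF M(2)] M(2)] by blast
  show ?thesis
  proof (rule that[of "max B M"])
    fix x :: real assume x: "x \<ge> 0"
    show "\<bar>u x\<bar> \<le> max B M * exp (c * \<phi> x)"
    proof (cases "x \<le> X")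
      case True
      hence "\<bar>u x\<bar> \<le> B * 1" using B(2) x by simp
      also have "\<dots> \<le> max B M * exp (c * \<phi> x)" using B c nonneg[OF x] by (intro mult_mono) auto
      finally show ?thesis .
    next
      case False
      hence "\<bar>u x\<bar> \<le> M * exp (c * \<phi> x)" using M(3) by simp
      also have "\<dots> \<le> max B M * exp (c * \<phi> x)" by (intro mult_right_mono) auto
      finally show ?thesis .
    qed
  qed
qed

text \<open>The linear extension to the left of \<open>0\<close> removes the one-sided derivative at \<open>0\<close>.\<close>

lemma c1_substitution_extension:
  assumes C1: "C1_on_halfline \<phi> \<phi>'" and mono: "mono_on {0..} \<phi>" and \<phi>0: "\<phi> 0 = 0"
    and unb: "filterlim \<phi> at_top at_top"
  shows "c1_substitution (\<lambda>x. if x \<ge> 0 then \<phi> x else \<phi>' 0 * x) (\<lambda>x. \<phi>' (max 0 x))"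
proof
  let ?\<Phi> = "\<lambda>x. if x \<ge> 0 then \<phi> x else \<phi>' 0 * x"
  have d: "(\<phi> has_real_derivative \<phi>' x) (at x within {0..})" if "x \<ge> 0" for x
    using C1 that by (simp add: C1_on_halfline_def)
  have c: "continuous_on {0..} \<phi>'" using C1 by (simp add: C1_on_halfline_def)
  fix x :: real
  show "(?\<Phi> has_real_derivative \<phi>' (max 0 x)) (at x)"
  proof -
    have right: "(?\<Phi> has_real_derivative \<phi>' (max 0 x)) (at x within {0..})" if "x \<ge> 0"
      by (rule has_field_derivative_transform_within[OF _ zero_less_one]) (use d[OF that] that in \<open>auto simp: max_def\<close>)
    have left: "(?\<Phi> has_real_derivative \<phi>' (max 0 x)) (at x within {..0})" if "x \<le> 0"
    proof (rule has_field_derivative_transform_within[OF _ zero_less_one])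
      show "((*) (\<phi>' 0) has_real_derivative \<phi>' (max 0 x)) (at x within {..0})"
        using that by (auto intro!: derivative_eq_intros simp: max_def)
    qed (use that \<phi>0 in auto)
    show ?thesis
    proof (cases x "0::real" rule: linorder_cases)
      case equal
      \<comment> \<open>At 0 both one-sided derivatives equal \<phi>'(0); the slope of the linear
        piece is chosen for this.\<close>
      have "(?\<Phi> has_real_derivative \<phi>' (max 0 x)) (at x within {..0} \<union> {0..})"
        using left right equal
        unfolding has_field_derivative_iff Lim_within_Un by blast
      moreover have "{..0} \<union> {0..} = (UNIV :: real set)" by auto
      ultimately show ?thesis by simp
    qed (use left right at_within_interior[of x "{..0::real}"] at_within_interior[of x "{0::real..}"] in auto)
  qed
  \<comment> \<open>Right-hand difference quotients of a monotone function are non-negative and are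
    available at 0 as well.\<close>
  show "\<phi>' (max 0 x) \<ge> 0"
  proof (rule tendsto_lowerbound)
    let ?y = "max 0 x"
    have "(\<phi> has_real_derivative \<phi>' ?y) (at ?y within {?y<..})"
      by (rule has_field_derivative_subset[OF d]) auto
    thus "((\<lambda>z. (\<phi> z - \<phi> ?y) / (z - ?y)) \<longlongrightarrow> \<phi>' ?y) (at_right ?y)"
      by (simp add: has_field_derivative_iff)
    show "\<forall>\<^sub>F z in at_right ?y. 0 \<le> (\<phi> z - \<phi> ?y) / (z - ?y)"
      using mono by (auto simp: eventually_at_filter mono_on_def intro!: divide_nonneg_nonneg always_eventually)
  qed simp
  show "continuous_on UNIV (\<lambda>x. \<phi>' (max 0 x))"
    by (rule continuous_on_compose2[OF c]) (auto intro!: continuous_intros)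
  show "?\<Phi> 0 = 0" using \<phi>0 by simp
  show "filterlim ?\<Phi> at_top at_top"
    using unb by (rule filterlim_cong[THEN iffD1, rotated 3])
      (auto intro: eventually_mono[OF eventually_ge_at_top[of 0]])
qed

thm_deps c1_substitution.gen_laplace_identity c1_substitution.laplace_series_conv

theorem theorem5p3:
  fixes \<phi> \<phi>' u :: "real \<Rightarrow> real"
    and \<alpha> \<beta> :: complex
    and a :: "nat \<Rightarrow> complex"
    and A :: "complex \<Rightarrow> complex"
    and R :: ereal
    and c :: real
    and u_hat :: "complex \<Rightarrow> complex"
  assumes phi_C1: "C1_on_halfline \<phi> \<phi>'"
    and phi_nonneg: "\<And>x. x \<ge> 0 \<Longrightarrow> \<phi> x \<ge> 0"
    and phi_mono: "mono_on {0..} \<phi>"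
    and phi_0: "\<phi> 0 = 0"
    and phi_unbounded: "filterlim \<phi> at_top at_top"
    and alpha: "Re \<alpha> > 0"
    and beta: "Re \<beta> > 0"
    and A_analytic: "A analytic_on eball 0 R"
    and A_series: "\<And>z. z \<in> eball 0 R \<Longrightarrow> (\<lambda>n. a n * z ^ n) sums A z"
    and R_large: "\<And>b. b > 0 \<Longrightarrow> ereal ((b - 0) powr Re \<beta>) < R"
    and A_Gamma: "conv_radius (gamma_coeff a \<alpha> \<beta>) > 0"
    and u_order: "phi_exponential_order \<phi> c u"
    and u_pc: "\<And>T. T > 0 \<Longrightarrow> piecewise_continuous_on 0 T u"
    and u_hat: "\<And>s L. has_gen_laplace \<phi> \<phi>' (\<lambda>x. of_real (u x)) s L \<Longrightarrow> u_hat s = L"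
  shows "(\<exists>\<sigma>. \<forall>s. Re s > \<sigma> \<longrightarrow>
            has_gen_laplace \<phi> \<phi>' (\<lambda>x. of_real (u x)) s (u_hat s) \<and>
            summable (\<lambda>n. gamma_coeff a \<alpha> \<beta> n * (s powr (- \<beta>)) ^ n) \<and>
            has_gen_laplace \<phi> \<phi>' (gen_frac_integral \<phi> \<phi>' \<alpha> \<beta> A u) s
              (s powr (- \<alpha>) * transformed_kernel a \<alpha> \<beta> (s powr (- \<beta>)) * u_hat s)) \<and>
         (\<forall>s L. Re s > 0 \<longrightarrow>
            has_gen_laplace \<phi> \<phi>' (\<lambda>x. of_real (u x)) s (u_hat s) \<longrightarrow>
            summable (\<lambda>n. gamma_coeff a \<alpha> \<beta> n * (s powr (- \<beta>)) ^ n) \<longrightarrow>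
            has_gen_laplace \<phi> \<phi>' (gen_frac_integral \<phi> \<phi>' \<alpha> \<beta> A u) s L \<longrightarrow>
            L = s powr (- \<alpha>) * transformed_kernel a \<alpha> \<beta> (s powr (- \<beta>)) * u_hat s)"
proof -
  define \<Phi> where "\<Phi> x = (if x \<ge> 0 then \<phi> x else \<phi>' 0 * x)" for x
  define \<Phi>' where "\<Phi>' x = \<phi>' (max 0 x)" for x
  interpret c1_substitution \<Phi> \<Phi>'
    unfolding \<Phi>_def[abs_def] \<Phi>'_def[abs_def] by (rule c1_substitution_extension[OF phi_C1 phi_mono phi_0 phi_unbounded])
  define v where "v x = complex_of_real (if x \<ge> 0 then u x else 0)" for x
  let ?k = "series_kernel \<alpha> \<beta> A" and ?r = "conv_radius (gamma_coeff a \<alpha> \<beta>)"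
  let ?T = "\<lambda>s. s powr (- \<alpha>) * transformed_kernel a \<alpha> \<beta> (s powr (- \<beta>))"
  \<comment> \<open>\<open>R_large\<close> holds for every b > 0; with b = (|z| + 1)^(1 / Re
    \<beta>) it puts an arbitrary z into the disc, so \<open>A\<close> is entire.\<close>
  have A_sums: "(\<lambda>n. a n * z ^ n) sums A z" for z
  proof (rule A_series)
    have "norm z \<le> (norm z + 1)" by simp
    also have "norm z + 1 = (((norm z + 1) powr (1 / Re \<beta>)) - 0) powr Re \<beta>"
      using beta norm_ge_zero[of z] by (simp add: powr_powr)
    finally have "ereal (norm z) \<le> ereal ((((norm z + 1) powr (1 / Re \<beta>)) - 0) powr Re \<beta>)"
      by (simp only: ereal_less_eq)
    also have "\<dots> < R"
      by (rule R_large) (use norm_ge_zero[of z] in \<open>auto simp: add_nonneg_eq_0_iff\<close>)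
    finally show "z \<in> eball 0 R" by simp
  qed
  obtain M where M: "\<And>x. x \<ge> 0 \<Longrightarrow> \<bar>u x\<bar> \<le> M * exp (c * \<phi> x)"
    using exponential_order_global_bound[OF u_order phi_nonneg u_pc] by blast
  have v_meas: "v \<in> borel_measurable borel"
    unfolding v_def[abs_def]
    by (rule measurable_compose[OF piecewise_continuous_imp_measurable[OF u_pc]]) measurable
  have v_neg: "v x = 0" if "x < 0" for x using that by (simp add: v_def)
  have v_bound: "norm (v x) \<le> M * exp (c * \<Phi> x)" if "x \<ge> 0" for x
    using M[OF that] that by (simp add: v_def \<Phi>_def)
  obtain \<sigma> where I_eq: "\<And>x. x \<ge> 0 \<Longrightarrow> mu_conv ?k v x = integral {0..x} (\<lambda>t. of_real (\<Phi>' t) * (?k (\<Phi> x - \<Phi> t) * v t))"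
    and v: "locally_mu_integrable v" and I: "locally_mu_integrable (mu_conv ?k v)"
    and real: "\<And>s. s > \<sigma> \<Longrightarrow> \<exists>L. has_gen_laplace \<Phi> \<Phi>' v (of_real s) L \<and>
      has_gen_laplace \<Phi> \<Phi>' (mu_conv ?k v) (of_real s) (?T (of_real s) * L)"
    by (rule laplace_series_conv[OF alpha beta A_sums A_Gamma v_meas v_neg v_bound]; (assumption | rule that))
  have lap_u: "has_gen_laplace \<phi> \<phi>' (\<lambda>x. of_real (u x)) s L \<longleftrightarrow> has_gen_laplace \<Phi> \<Phi>' v s L" for s L
    by (rule has_gen_laplace_cong) (auto simp: \<Phi>_def \<Phi>'_def v_def)
  have lap_I: "has_gen_laplace \<phi> \<phi>' (gen_frac_integral \<phi> \<phi>' \<alpha> \<beta> A u) s L \<longleftrightarrow>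
      has_gen_laplace \<Phi> \<Phi>' (mu_conv ?k v) s L" for s L
  proof (rule has_gen_laplace_cong)
    fix x :: real assume x: "x \<ge> 0"
    show "gen_frac_integral \<phi> \<phi>' \<alpha> \<beta> A u x = mu_conv ?k v x"
      unfolding I_eq[OF x] gen_frac_integral_def
    proof (rule integral_cong)
      fix t assume t: "t \<in> {0..x}"
      hence "\<phi> t \<le> \<phi> x" using phi_mono by (auto simp: mono_on_def)
      \<comment> \<open>If \<phi> t = \<phi> x, both sides are 0, by \<open>0 powr w = 0\<close> on
        the left and the cut-off of the kernel on the right.\<close>
      thus "of_real (\<phi>' t) * of_real (\<phi> x - \<phi> t) powr (\<alpha> - 1) * A (of_real (\<phi> x - \<phi> t) powr \<beta>) * of_real (u t) =
          of_real (\<Phi>' t) * (?k (\<Phi> x - \<Phi> t) * v t)"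
        using t x by (auto simp: \<Phi>_def \<Phi>'_def v_def series_kernel_def mult.assoc)
    qed
  qed (auto simp: \<Phi>_def \<Phi>'_def)
  show ?thesis
  proof (intro conjI allI impI)
    \<comment> \<open>A non-negative real base point beyond \<sigma>, at which \<open>real\<close>
      supplies both transforms.\<close>
    define x0 where "x0 = max 0 \<sigma> + 1"
    have x0: "Re (complex_of_real x0) \<ge> 0" "x0 > \<sigma>" by (auto simp: x0_def)
    obtain \<tau> where \<tau>: "\<tau> > x0" "{s. Re s > \<tau>} \<subseteq> laplace_region \<beta> ?r x0"
      using halfplane_subset_laplace_region[OF beta A_Gamma, of x0] x0 by auto
    from real[OF x0(2)] obtain L where L: "has_gen_laplace \<Phi> \<Phi>' v (of_real x0) L"
      "has_gen_laplace \<Phi> \<Phi>' (mu_conv ?k v) (of_real x0) (?T (of_real x0) * L)" by blast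
    obtain F where F: "\<And>s. Re s > x0 \<Longrightarrow> has_gen_laplace \<Phi> \<Phi>' v s (F s)"
      "\<And>s. s \<in> laplace_region \<beta> ?r x0 \<Longrightarrow> has_gen_laplace \<Phi> \<Phi>' (mu_conv ?k v) s (?T s * F s)"
      using gen_laplace_identity[OF beta A_Gamma x0(1) v I L real] by auto
    show "\<exists>\<sigma>. \<forall>s. Re s > \<sigma> \<longrightarrow>
            has_gen_laplace \<phi> \<phi>' (\<lambda>x. of_real (u x)) s (u_hat s) \<and>
            summable (\<lambda>n. gamma_coeff a \<alpha> \<beta> n * (s powr (- \<beta>)) ^ n) \<and>
            has_gen_laplace \<phi> \<phi>' (gen_frac_integral \<phi> \<phi>' \<alpha> \<beta> A u) s (?T s * u_hat s)"
    proof (intro exI[of _ \<tau>] allI impI)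
      fix s assume s: "Re s > \<tau>"
      with \<tau> have sr: "s \<in> laplace_region \<beta> ?r x0" by auto
      have lu: "has_gen_laplace \<Phi> \<Phi>' v s (F s)" using s \<tau>(1) by (intro F) simp
      hence "u_hat s = F s" by (intro u_hat) (simp add: lap_u)
      moreover have "summable (\<lambda>n. gamma_coeff a \<alpha> \<beta> n * (s powr (- \<beta>)) ^ n)"
        using sr by (intro summable_in_conv_radius) (simp add: laplace_region_def)
      ultimately show "has_gen_laplace \<phi> \<phi>' (\<lambda>x. of_real (u x)) s (u_hat s) \<and>
            summable (\<lambda>n. gamma_coeff a \<alpha> \<beta> n * (s powr (- \<beta>)) ^ n) \<and>
            has_gen_laplace \<phi> \<phi>' (gen_frac_integral \<phi> \<phi>' \<alpha> \<beta> A u) s (?T s * u_hat s)"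
        using lu F(2)[OF sr] by (simp add: lap_u lap_I)
    qed
  next
    fix s L
    assume s: "Re s > 0"
      and lu: "has_gen_laplace \<phi> \<phi>' (\<lambda>x. of_real (u x)) s (u_hat s)"
      and sum: "summable (\<lambda>n. gamma_coeff a \<alpha> \<beta> n * (s powr (- \<beta>)) ^ n)"
      and lI: "has_gen_laplace \<phi> \<phi>' (gen_frac_integral \<phi> \<phi>' \<alpha> \<beta> A u) s L"
    \<comment> \<open>Here the base point is \<open>s\<close> itself, where both transforms are only
      assumed to converge; the boundary case of \<open>gen_laplace_identity\<close> applies.\<close>
    show "L = ?T s * u_hat s"
      using gen_laplace_identity[OF beta A_Gamma less_imp_le[OF s] v I lu[unfolded lap_u] lI[unfolded lap_I] real] s sum
      by blast
  qed
qed

end
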